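(* Let $M$ be a compact connected non-orientable surface and let $k\ge 1$. The homomorphism $\widetilde{\Gamma}^k(M)\to\Gamma^k(M)$ induced by the inclusion $\mathrm{Diff}_0(M)\cap\mathrm{Diff}(M;k)\subseteq \mathrm{Diff}(M;k)$ is injective, so that the reduced mapping class group $\widetilde{\Gamma}^k(M)$ is naturally a subgroup of $\Gamma^k(M)$, and it fits into an exact sequence of groups $$1\longrightarrow \widetilde{\Gamma}^k(M)\longrightarrow \Gamma^k(M)\longrightarrow \Gamma(M)\longrightarrow 1 .$$
   Context: $\mathrm{Diff}(M)$ is the group of all diffeomorphisms of $M$ under the compact-open topology, and $\mathrm{Diff}_0(M)$ is its identity component (the diffeomorphisms isotopic to the identity). Fix a set of $k$ distinct (interior) points of $M$; $\mathrm{Diff}(M;k)\subseteq\mathrm{Diff}(M)$ is the subgroup of diffeomorphisms that leave this set invariant (possibly permuting the points). The mapping class groups are $\Gamma(M)=\pi_0\mathrm{Diff}(M)=\mathrm{Diff}(M)/\mathrm{Diff}_0(M)$ and $\Gamma^k(M)=\pi_0\mathrm{Diff}(M;k)$. The reduced mapping class group of $M$ with $k$ marked points is $\widetilde{\Gamma}^k(M)=\pi_0(\mathrm{Diff}_0(M)\cap\mathrm{Diff}(M;k))$, where $\mathrm{Diff}_0(M)\cap\mathrm{Diff}(M;k)$ has the subspace topology. *)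

theory Defs
  imports
    "HOL-Analysis.Analysis"
    "HOL-Algebra.Bij"
    "HOL-Algebra.Exact_Sequence"
begin

section \<open>Smooth maps on subsets of Euclidean space\<close>

text \<open>Only meaningful for open \<open>S\<close>: in finite dimension it is \<open>C\<^sup>n\<close> in the usual sense.\<close>

primrec Ck_on :: "nat \<Rightarrow> 'a::real_normed_vector set \<Rightarrow> ('a \<Rightarrow> 'b::real_normed_vector) \<Rightarrow> bool" where
  "Ck_on 0 S f \<longleftrightarrow> continuous_on S f"
| "Ck_on (Suc n) S f \<longleftrightarrow>
     (\<forall>x\<in>S. f differentiable (at x)) \<and>
     (\<forall>v. Ck_on n S (\<lambda>x. frechet_derivative f (at x) v))"

text \<open>On a set that need not be open, smoothness means having smooth extensions locally; this
  is what is needed at boundary points of the half-plane.\<close>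

definition smooth_on :: "'a::real_normed_vector set \<Rightarrow> ('a \<Rightarrow> 'b::real_normed_vector) \<Rightarrow> bool" where
  "smooth_on S f \<longleftrightarrow>
     (\<forall>x\<in>S. \<exists>W g. open W \<and> x \<in> W \<and> (\<forall>n. Ck_on n W g) \<and> (\<forall>y\<in>W \<inter> S. g y = f y))"


section \<open>Smooth surfaces, possibly with boundary\<close>

definition half_plane :: "(real^2) set" where
  "half_plane = {x. 0 \<le> x $ 1}"

text \<open>A chart is its domain together with its coordinate map, whose values off the domain are
  irrelevant.\<close>

type_synonym 'a chart = "'a set \<times> ('a \<Rightarrow> real^2)"

definition is_chart :: "'a topology \<Rightarrow> 'a chart \<Rightarrow> bool" where
  "is_chart X = (\<lambda>(U, \<phi>).
     openin X U \<and> openin (top_of_set half_plane) (\<phi> ` U) \<and>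
     homeomorphic_map (subtopology X U) (top_of_set (\<phi> ` U)) \<phi>)"

text \<open>Atlases are not required to be maximal.\<close>

definition smooth_atlas :: "'a topology \<Rightarrow> 'a chart set \<Rightarrow> bool" where
  "smooth_atlas X A \<longleftrightarrow>
     (\<forall>c\<in>A. is_chart X c) \<and>
     (\<Union>(U, \<phi>)\<in>A. U) = topspace X \<and>
     (\<forall>(U, \<phi>)\<in>A. \<forall>(V, \<psi>)\<in>A. smooth_on (\<phi> ` (U \<inter> V)) (\<psi> \<circ> inv_into U \<phi>))"

definition smooth_surface :: "'a topology \<Rightarrow> 'a chart set \<Rightarrow> bool" where
  "smooth_surface X A \<longleftrightarrow> Hausdorff_space X \<and> second_countable X \<and> smooth_atlas X A"

definition surface_interior :: "'a chart set \<Rightarrow> 'a set" where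
  "surface_interior A = {p. \<exists>(U, \<phi>)\<in>A. p \<in> U \<and> \<phi> p \<in> interior half_plane}"

text \<open>The derivative is taken within the (relatively open) domain of the transition map, where
  it is unique, so the condition also makes sense at boundary points.\<close>

definition oriented_atlas :: "'a chart set \<Rightarrow> bool" where
  "oriented_atlas A \<longleftrightarrow>
     (\<forall>(U, \<phi>)\<in>A. \<forall>(V, \<psi>)\<in>A. \<forall>x\<in>\<phi> ` (U \<inter> V).
        \<exists>D. ((\<psi> \<circ> inv_into U \<phi>) has_derivative D) (at x within \<phi> ` (U \<inter> V)) \<and>
            det (matrix D) > 0)"

text \<open>\<open>smooth_atlas X (A \<union> B)\<close> says that \<open>B\<close> is compatible with the smooth structure
  determined by \<open>A\<close>.\<close>

definition orientable :: "'a topology \<Rightarrow> 'a chart set \<Rightarrow> bool" where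
  "orientable X A \<longleftrightarrow> (\<exists>B. smooth_atlas X B \<and> smooth_atlas X (A \<union> B) \<and> oriented_atlas B)"

definition smooth_map ::
    "'a topology \<Rightarrow> 'a chart set \<Rightarrow> 'b topology \<Rightarrow> 'b chart set \<Rightarrow> ('a \<Rightarrow> 'b) \<Rightarrow> bool" where
  "smooth_map X A Y B f \<longleftrightarrow>
     continuous_map X Y f \<and>
     (\<forall>(U, \<phi>)\<in>A. \<forall>(V, \<psi>)\<in>B. smooth_on (\<phi> ` {x\<in>U. f x \<in> V}) (\<psi> \<circ> f \<circ> inv_into U \<phi>))"


section \<open>Diffeomorphism groups\<close>

text \<open>As in \<^const>\<open>BijGroup\<close>, self-maps of the surface are functions that are \<^const>\<open>undefined\<close>
  outside \<^term>\<open>topspace X\<close>.\<close>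

definition Diff :: "'a topology \<Rightarrow> 'a chart set \<Rightarrow> ('a \<Rightarrow> 'a) set" where
  "Diff X A = {f \<in> Bij (topspace X).
     smooth_map X A X A f \<and> smooth_map X A X A (inv_into (topspace X) f)}"

definition compact_open_topology :: "'a topology \<Rightarrow> 'b topology \<Rightarrow> ('a \<Rightarrow> 'b) topology" where
  "compact_open_topology X Y = topology_generated_by
     {{f \<in> extensional (topspace X). continuous_map X Y f \<and> f ` K \<subseteq> V} |K V.
        compactin X K \<and> openin Y V}"

definition diffeo_group :: "'a topology \<Rightarrow> ('a \<Rightarrow> 'a) set \<Rightarrow> ('a \<Rightarrow> 'a) monoid" where
  "diffeo_group X D = (BijGroup (topspace X))\<lparr>carrier := D\<rparr>"

definition diffeo_topology :: "'a topology \<Rightarrow> ('a \<Rightarrow> 'a) set \<Rightarrow> ('a \<Rightarrow> 'a) topology" where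
  "diffeo_topology X D = subtopology (compact_open_topology X X) D"

text \<open>The path component of the identity.\<close>

definition Diff0 :: "'a topology \<Rightarrow> 'a chart set \<Rightarrow> ('a \<Rightarrow> 'a) set" where
  "Diff0 X A = path_component_of_set (diffeo_topology X (Diff X A)) (\<lambda>x\<in>topspace X. x)"

definition Diff_marked :: "'a topology \<Rightarrow> 'a chart set \<Rightarrow> 'a set \<Rightarrow> ('a \<Rightarrow> 'a) set" where
  "Diff_marked X A P = {f \<in> Diff X A. f ` P = P}"


section \<open>Groups of path components\<close>

text \<open>The group of path components of a topological group with underlying group \<open>G\<close> and
  topology \<open>T\<close>; the product of the classes of \<open>x\<close> and \<open>y\<close> is the class of their product.\<close>

definition pi0_group :: "('g, 'm) monoid_scheme \<Rightarrow> 'g topology \<Rightarrow> 'g set monoid" where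
  "pi0_group G T =
     \<lparr>carrier = path_components_of T,
      monoid.mult = (\<lambda>C D. \<Union>x\<in>C. \<Union>y\<in>D. path_component_of_set T (x \<otimes>\<^bsub>G\<^esub> y)),
      one = path_component_of_set T \<one>\<^bsub>G\<^esub>\<rparr>"

text \<open>The map on path components induced by a continuous map \<open>f\<close> into a space with topology \<open>T\<close>.\<close>

definition pi0_map :: "'h topology \<Rightarrow> ('g \<Rightarrow> 'h) \<Rightarrow> 'g set \<Rightarrow> 'h set" where
  "pi0_map T f C = (\<Union>x\<in>C. path_component_of_set T (f x))"


section \<open>Mapping class groups\<close>

definition pi0_diffeo :: "'a topology \<Rightarrow> ('a \<Rightarrow> 'a) set \<Rightarrow> ('a \<Rightarrow> 'a) set monoid" where
  "pi0_diffeo X D = pi0_group (diffeo_group X D) (diffeo_topology X D)"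

definition MCG :: "'a topology \<Rightarrow> 'a chart set \<Rightarrow> ('a \<Rightarrow> 'a) set monoid" where
  "MCG X A = pi0_diffeo X (Diff X A)"

definition MCG_marked :: "'a topology \<Rightarrow> 'a chart set \<Rightarrow> 'a set \<Rightarrow> ('a \<Rightarrow> 'a) set monoid" where
  "MCG_marked X A P = pi0_diffeo X (Diff_marked X A P)"

definition reduced_MCG :: "'a topology \<Rightarrow> 'a chart set \<Rightarrow> 'a set \<Rightarrow> ('a \<Rightarrow> 'a) set monoid" where
  "reduced_MCG X A P = pi0_diffeo X (Diff0 X A \<inter> Diff_marked X A P)"

definition reduced_to_marked ::
    "'a topology \<Rightarrow> 'a chart set \<Rightarrow> 'a set \<Rightarrow> ('a \<Rightarrow> 'a) set \<Rightarrow> ('a \<Rightarrow> 'a) set" where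
  "reduced_to_marked X A P = pi0_map (diffeo_topology X (Diff_marked X A P)) (\<lambda>f. f)"

definition forget_marked ::
    "'a topology \<Rightarrow> 'a chart set \<Rightarrow> ('a \<Rightarrow> 'a) set \<Rightarrow> ('a \<Rightarrow> 'a) set" where
  "forget_marked X A = pi0_map (diffeo_topology X (Diff X A)) (\<lambda>f. f)"

end

theory Submission
  imports Defs
begin

text \<open>Injectivity and exactness at \<open>\<Gamma>\<^sup>k\<close> hold because a path of diffeomorphisms that starts in the
  identity component stays there. Surjectivity of \<open>\<Gamma>\<^sup>k \<rightarrow> \<Gamma>\<close> is the homogeneity of the interior:
  a finite set of interior points can be carried onto any other one of the same size by a
  diffeomorphism isotopic to the identity. The points are moved one at a time. The local moves are
  twists \<open>x \<mapsto> c + e\<^bsup>i\<theta>(|x - c|)\<^esup> (x - c)\<close> in a chart, which are compactly supported and have explicit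
  smooth inverses, so that neither flows nor the inverse function theorem are needed. The orbits of
  these moves are open, and since the interior minus a finite set is dense and locally connected at
  every point of the connected surface, there is only one orbit.\<close>

section \<open>Functions of class \<open>C\<^sup>n\<close>\<close>

text \<open>A point is carried to a nearby one by a half turn about their midpoint, so one family of
  twists supplies all local moves; scaling the angle down to zero deforms such a move to the
  identity. The flat function exp (-1/u) lets a twist become the identity smoothly at the rim of its
  disc. The obstacle in the global step is that connectedness is given for the whole surface,
  whereas the orbits live in the interior minus a finite set. An orbit and its complement are
  therefore thickened to open subsets of the whole surface: density makes the thickenings disjoint,
  and connected traces near every point, boundary points and punctures included, make them cover.
  Here dimension two matters: a convex open set stays connected without finitely many of its points.
  Boundary points force coordinates in a half-plane, where smoothness means local extendability.
  They also require that being interior does not depend on the chart; invariance of domain supplies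
  this and shows that diffeomorphisms preserve the interior.\<close>

lemma Ck_on_cong:
  assumes "open S" "\<And>x. x \<in> S \<Longrightarrow> f x = g x"
  shows "Ck_on n S f \<longleftrightarrow> Ck_on n S g"
  using assms(2)
proof (induction n arbitrary: f g)
  case 0
  then show ?case by (simp cong: continuous_on_cong)
next
  case (Suc n)
  have fd: "frechet_derivative f (at x) = frechet_derivative g (at x)" if "x \<in> S" for x
  proof -
    have "(f has_derivative D) (at x) \<longleftrightarrow> (g has_derivative D) (at x)" for D
      using has_derivative_transform_within_open[OF _ \<open>open S\<close> that] Suc.prems by metis
    then show ?thesis by (simp add: frechet_derivative_def)
  qed
  have "f differentiable (at x) \<longleftrightarrow> g differentiable (at x)" if "x \<in> S" for x
    using has_derivative_transform_within_open[OF _ \<open>open S\<close> that] Suc.prems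
    unfolding differentiable_def by metis
  moreover have "Ck_on n S (\<lambda>x. frechet_derivative f (at x) v)
      \<longleftrightarrow> Ck_on n S (\<lambda>x. frechet_derivative g (at x) v)" for v
    by (rule Suc.IH) (simp add: fd)
  ultimately show ?case by simp
qed

text \<open>The derivatives are taken at a point and not within the set, so the recursion passes to
  arbitrary subsets.\<close>

lemma Ck_on_subset: "Ck_on n S f \<Longrightarrow> T \<subseteq> S \<Longrightarrow> Ck_on n T f"
  by (induction n arbitrary: f) (auto intro: continuous_on_subset)

lemma Ck_on_imp_continuous_on: "Ck_on n S f \<Longrightarrow> continuous_on S f"
  by (cases n)
    (auto intro!: differentiable_imp_continuous_within continuous_at_imp_continuous_on)

lemma Ck_on_Suc_D: "Ck_on (Suc n) S f \<Longrightarrow> Ck_on n S f"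
proof (induction n arbitrary: f)
  case 0
  then show ?case using Ck_on_imp_continuous_on[OF 0] by simp
next
  case (Suc n)
  then show ?case by (metis Ck_on.simps(2))
qed

text \<open>\<open>frechet_derivative\<close> is defined by choice. Uniqueness of derivatives at a
  point identifies any known \<open>f'\<close> with it, so that later proofs can compute with
  explicit derivatives.\<close>

lemma Ck_on_SucI:
  assumes "open S" "\<And>x. x \<in> S \<Longrightarrow> (f has_derivative f' x) (at x)"
    "\<And>v. Ck_on n S (\<lambda>x. f' x v)"
  shows "Ck_on (Suc n) S f"
proof -
  have "f' x = frechet_derivative f (at x)" if "x \<in> S" for x
    using frechet_derivative_at[OF assms(2)[OF that]] .
  then have "Ck_on n S (\<lambda>x. frechet_derivative f (at x) v)" for v
    using assms(3)[of v] by (subst Ck_on_cong[OF assms(1), of _ "\<lambda>x. f' x v"]) auto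
  then show ?thesis using assms(2) by (auto simp: differentiable_def)
qed

lemma Ck_on_has_derivative:
  assumes "Ck_on (Suc n) S f" "x \<in> S"
  shows "(f has_derivative frechet_derivative f (at x)) (at x)"
  using assms frechet_derivative_works by auto

lemma Ck_on_const: "open S \<Longrightarrow> Ck_on n S (\<lambda>x. c)"
proof (induction n arbitrary: c)
  case 0 then show ?case by simp
next
  case (Suc n)
  then show ?case by (auto intro!: Ck_on_SucI[where f' = "\<lambda>_ _. 0"])
qed

lemma Ck_on_linear: "open S \<Longrightarrow> bounded_linear L \<Longrightarrow> Ck_on n S L"
proof (cases n)
  case 0
  assume "bounded_linear L"
  then show ?thesis using 0 by (simp add: linear_continuous_on)
next
  case (Suc m)
  assume "open S" "bounded_linear L"
  then show ?thesis unfolding Suc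
    by (intro Ck_on_SucI[where f' = "\<lambda>_. L"]) (auto intro: bounded_linear_imp_has_derivative Ck_on_const)
qed

lemma Ck_on_linear_image:
  assumes "open S" "bounded_linear L" "Ck_on n S f"
  shows "Ck_on n S (\<lambda>x. L (f x))"
  using assms(3)
proof (induction n arbitrary: f)
  case 0
  then show ?case using assms(2) by (auto intro: bounded_linear.continuous_on)
next
  case (Suc n)
  show ?case
  proof (rule Ck_on_SucI[OF assms(1)])
    show "((\<lambda>x. L (f x)) has_derivative (\<lambda>v. L (frechet_derivative f (at x) v))) (at x)" if "x \<in> S" for x
      using bounded_linear.has_derivative[OF assms(2) Ck_on_has_derivative[OF Suc.prems that]] .
    show "Ck_on n S (\<lambda>x. L (frechet_derivative f (at x) v))" for v
      using Suc by auto
  qed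
qed

lemma Ck_on_add:
  assumes "open S" "Ck_on n S f" "Ck_on n S g"
  shows "Ck_on n S (\<lambda>x. f x + g x)"
  using assms(2,3)
proof (induction n arbitrary: f g)
  case 0
  then show ?case by (auto intro: continuous_on_add)
next
  case (Suc n)
  show ?case
  proof (rule Ck_on_SucI[OF assms(1)])
    show "((\<lambda>x. f x + g x) has_derivative
        (\<lambda>v. frechet_derivative f (at x) v + frechet_derivative g (at x) v)) (at x)" if "x \<in> S" for x
      using has_derivative_add Ck_on_has_derivative Suc.prems that by blast
    show "Ck_on n S (\<lambda>x. frechet_derivative f (at x) v + frechet_derivative g (at x) v)" for v
      using Suc by auto
  qed
qed

lemma Ck_on_diff:
  assumes "open S" "Ck_on n S f" "Ck_on n S g"
  shows "Ck_on n S (\<lambda>x. f x - g x)"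
  using Ck_on_add[OF assms(1,2) Ck_on_linear_image[OF assms(1) bounded_linear_minus[OF bounded_linear_ident] assms(3)]]
  by simp

lemma Ck_on_sum:
  assumes "open S" "\<And>i. i \<in> I \<Longrightarrow> Ck_on n S (f i)"
  shows "Ck_on n S (\<lambda>x. \<Sum>i\<in>I. f i x)"
  using assms(2)
  by (induction I rule: infinite_finite_induct) (auto intro: Ck_on_const Ck_on_add assms(1))

lemma Ck_on_bilinear:
  assumes "open S" "bounded_bilinear B" "Ck_on n S f" "Ck_on n S g"
  shows "Ck_on n S (\<lambda>x. B (f x) (g x))"
  using assms(3,4)
proof (induction n arbitrary: f g)
  case 0
  then show ?case using assms(2) by (auto intro: bounded_bilinear.continuous_on)
next
  case (Suc n)
  show ?case
  proof (rule Ck_on_SucI[OF assms(1)])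
    show "((\<lambda>x. B (f x) (g x)) has_derivative
        (\<lambda>v. B (f x) (frechet_derivative g (at x) v) + B (frechet_derivative f (at x) v) (g x))) (at x)"
      if "x \<in> S" for x
      using bounded_bilinear.FDERIV[OF assms(2) Ck_on_has_derivative[OF Suc.prems(1) that]
          Ck_on_has_derivative[OF Suc.prems(2) that]] .
    \<comment> \<open>Each summand of the product rule keeps one factor undifferentiated, and that
      factor has one order of smoothness to spare.\<close>
    show "Ck_on n S (\<lambda>x. B (f x) (frechet_derivative g (at x) v)
        + B (frechet_derivative f (at x) v) (g x))" for v
      using Suc Ck_on_Suc_D[OF Suc.prems(1)] Ck_on_Suc_D[OF Suc.prems(2)]
      by (intro Ck_on_add[OF assms(1)]) auto
  qed
qed

text \<open>Expanding \<open>Df(x)v\<close> in the basis turns the chain rule into a sum of products of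
  \<open>C\<^sup>n\<close> functions to which the induction hypothesis applies.\<close>

lemma Ck_on_compose:
  fixes f :: "'a::real_normed_vector \<Rightarrow> 'b::euclidean_space"
    and g :: "'b \<Rightarrow> 'c::real_normed_vector"
  assumes "open S" "open T" "f ` S \<subseteq> T" "Ck_on n S f" "Ck_on n T g"
  shows "Ck_on n S (\<lambda>x. g (f x))"
  using assms(4,5)
proof (induction n arbitrary: g)
  case 0
  then show ?case using assms(3) continuous_on_compose2 by auto
next
  case (Suc n)
  let ?f = "\<lambda>x. frechet_derivative f (at x)" and ?g = "\<lambda>y. frechet_derivative g (at y)"
  have lin: "bounded_linear (?g (f x))" if "x \<in> S" for x
    using Ck_on_has_derivative[OF Suc.prems(2)] that assms(3) has_derivative_bounded_linear by blast
  have eq: "?g (f x) (?f x v) = (\<Sum>b\<in>Basis. (?f x v \<bullet> b) *\<^sub>R ?g (f x) b)" if "x \<in> S" for x v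
  proof -
    interpret bounded_linear "?g (f x)" by (rule lin[OF that])
    show ?thesis
      by (subst (1) euclidean_representation[symmetric, of "?f x v"]) (simp only: sum scaleR)
  qed
  have ck: "Ck_on n S (\<lambda>x. \<Sum>b\<in>Basis. (?f x v \<bullet> b) *\<^sub>R ?g (f x) b)" for v
  proof (intro Ck_on_sum[OF assms(1)] Ck_on_bilinear[OF assms(1) bounded_bilinear_scaleR])
    fix b :: 'b assume "b \<in> Basis"
    show "Ck_on n S (\<lambda>x. ?f x v \<bullet> b)"
      using Suc.prems(1) by (intro Ck_on_linear_image[OF assms(1) bounded_linear_inner_left]) auto
    show "Ck_on n S (\<lambda>x. ?g (f x) b)"
      using Suc.prems by (intro Suc.IH Ck_on_Suc_D[OF Suc.prems(1)]) auto
  qed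
  show ?case
  proof (rule Ck_on_SucI[OF assms(1)])
    show "((\<lambda>x. g (f x)) has_derivative (\<lambda>v. ?g (f x) (?f x v))) (at x)" if "x \<in> S" for x
      using has_derivative_compose[OF Ck_on_has_derivative[OF Suc.prems(1) that]
        Ck_on_has_derivative[OF Suc.prems(2)]] that assms(3) by auto
    show "Ck_on n S (\<lambda>x. ?g (f x) (?f x v))" for v
      using ck[of v] by (subst Ck_on_cong[OF assms(1)]) (auto simp: eq)
  qed
qed

section \<open>Trigonometric functions and the flat bump\<close>

lemma Ck_on_real_SucI:
  fixes f :: "real \<Rightarrow> real"
  assumes "\<And>x. DERIV f x :> f' x" "Ck_on n UNIV f'"
  shows "Ck_on (Suc n) UNIV f"
proof (rule Ck_on_SucI[OF open_UNIV])
  show "(f has_derivative (\<lambda>v. f' x * v)) (at x)" for x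
    using assms(1)[of x] by (simp add: has_field_derivative_def)
  show "Ck_on n UNIV (\<lambda>x. f' x * v)" for v
    by (rule Ck_on_linear_image[OF _ bounded_linear_mult_left assms(2)]) simp
qed

text \<open>Both claims go through one induction since each function is, up to sign, the derivative
  of the other.\<close>

lemma Ck_on_sin_cos: "Ck_on n UNIV (sin :: real \<Rightarrow> real)" "Ck_on n UNIV (cos :: real \<Rightarrow> real)"
proof (induction n)
  case 0
  case 1 show ?case by (simp add: continuous_on_sin continuous_on_id)
  case 2 show ?case by (simp add: continuous_on_cos continuous_on_id)
next
  case (Suc n)
  case 1 show ?case
    by (rule Ck_on_real_SucI[OF DERIV_sin Suc(2)])
  case 2 show ?case
    by (rule Ck_on_real_SucI[OF DERIV_cos])
      (rule Ck_on_linear_image[OF _ bounded_linear_minus[OF bounded_linear_ident] Suc(1)], simp)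
qed

text \<open>The family \<open>u\<^sup>-\<^sup>k exp (-1/u)\<close>, extended by \<open>0\<close> to \<open>u \<le> 0\<close>, is closed under
  differentiation up to linear combinations.\<close>

definition bump :: "nat \<Rightarrow> real \<Rightarrow> real" where
  "bump k u = (if u \<le> 0 then 0 else exp (- (1 / u)) / u ^ k)"

text \<open>In the variable x = 1/u the function is x^k / exp x, and the exponential outgrows every
  power.\<close>

lemma bump_tendsto_0: "(bump k \<longlongrightarrow> 0) (at_right 0)"
proof -
  have "((\<lambda>x::real. x ^ k / exp x) \<longlongrightarrow> 0) at_top"
    by (rule tendsto_power_div_exp_0)
  then have "((\<lambda>u::real. inverse u ^ k / exp (inverse u)) \<longlongrightarrow> 0) (at_right 0)"
    by (rule filterlim_compose[OF _ filterlim_inverse_at_top_right])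
  moreover have "eventually (\<lambda>u::real. inverse u ^ k / exp (inverse u) = bump k u) (at_right 0)"
    by (auto simp: eventually_at_filter bump_def exp_minus field_simps)
  ultimately show ?thesis by (rule Lim_transform_eventually)
qed

text \<open>For u > 0 the exponential contributes a factor u^-2 and the power a factor -k/u; at the
  origin flatness takes over.\<close>

lemma DERIV_bump: "DERIV (bump k) u :> bump (k + 2) u - of_nat k * bump (k + 1) u"
proof -
  consider "u < 0" | "u > 0" | "u = 0" by linarith
  then show ?thesis
  proof cases
    case 1
    have "((\<lambda>_. 0::real) has_field_derivative 0) (at u)" by simp
    moreover have "eventually (\<lambda>x. bump k x = 0) (nhds u)"
      using order_tendstoD(2)[OF filterlim_ident[of "nhds u"], of 0] 1
      by (auto elim!: eventually_mono simp: bump_def)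
    ultimately show ?thesis using 1
      by (subst DERIV_cong_ev[OF refl _ refl, of _ "\<lambda>_. 0"]) (auto simp: bump_def)
  next
    case 2
    have ev: "eventually (\<lambda>x. bump k x = exp (- (1 / x)) / x ^ k) (nhds u)"
      using order_tendstoD(1)[OF filterlim_ident[of "nhds u"], of 0] 2
      by (auto elim!: eventually_mono simp: bump_def)
    have pw: "u * u ^ (m - Suc 0) = u ^ m" if "m \<noteq> 0" for m
      using that by (simp add: power_eq_if)
    have "((\<lambda>x. exp (- (1 / x)) / x ^ k) has_field_derivative
       bump (k + 2) u - of_nat k * bump (k + 1) u) (at u)"
      using 2 by (cases k; auto intro!: derivative_eq_intros
          simp: bump_def power2_eq_square field_simps; metis pw)
    then show ?thesis by (subst DERIV_cong_ev[OF refl ev refl])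
  next
    case 3
    \<comment> \<open>To the right of the origin the difference quotient is again a member of the
      family, \<open>bump (Suc k) h\<close>; to the left it vanishes.\<close>
    have "((\<lambda>h. bump k h / h) \<longlongrightarrow> 0) (at 0)"
    proof (rule filterlim_split_at)
      show "((\<lambda>h. bump k h / h) \<longlongrightarrow> 0) (at_left 0)"
        by (rule tendsto_eventually) (auto simp: eventually_at_filter bump_def)
      show "((\<lambda>h. bump k h / h) \<longlongrightarrow> 0) (at_right 0)"
        by (rule Lim_transform_eventually[OF bump_tendsto_0[of "Suc k"]])
          (auto simp: eventually_at_filter bump_def field_simps)
    qed
    then show ?thesis by (simp add: DERIV_def 3 bump_def)
  qed
qed

lemma Ck_on_bump: "Ck_on n UNIV (bump k)"
proof (induction n arbitrary: k)
  case 0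
  show ?case using DERIV_isCont[OF DERIV_bump] by (simp add: continuous_at_imp_continuous_on)
next
  case (Suc n)
  show ?case
    by (rule Ck_on_real_SucI[OF DERIV_bump])
      (intro Ck_on_diff Suc Ck_on_linear_image[OF _ bounded_linear_mult_right] open_UNIV)
qed

section \<open>Groups of path components\<close>

text \<open>Continuity of translations is enough: paths are multiplied one factor at a time, and the
  inverse of a class is the class of an inverse, so inversion never has to act on paths.\<close>

locale pi0_grp = group G for G :: "('g, 'm) monoid_scheme" (structure) +
  fixes T :: "'g topology"
  assumes topspace_eq: "topspace T = carrier G"
    and left_cont: "a \<in> carrier G \<Longrightarrow> continuous_map T T (\<lambda>x. a \<otimes> x)"
    and right_cont: "a \<in> carrier G \<Longrightarrow> continuous_map T T (\<lambda>x. x \<otimes> a)"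
begin

abbreviation cls :: "'g \<Rightarrow> 'g set" where "cls \<equiv> path_component_of_set T"

lemma cls_self: "x \<in> carrier G \<Longrightarrow> x \<in> cls x"
  by (simp add: path_component_of_refl topspace_eq)

text \<open>If \<open>y\<close> lies outside the carrier, its class is empty while that of
  \<open>x\<close> is not, and both sides are false.\<close>

lemma cls_eq_iff: "x \<in> carrier G \<Longrightarrow> cls x = cls y \<longleftrightarrow> path_component_of T x y"
  by (metis Collect_cong mem_Collect_eq path_component_of_refl path_component_of_sym
      path_component_of_trans topspace_eq)

lemma path_component_of_in: "path_component_of T x y \<Longrightarrow> x \<in> carrier G \<and> y \<in> carrier G"
  using path_component_of_equiv[of T x y] path_component_in_topspace[of T x y] topspace_eq by auto

text \<open>A right translation joins the product of \<open>x\<close> and \<open>y\<close> to that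
  of \<open>x'\<close> and \<open>y\<close>, and a left translation continues to that of
  \<open>x'\<close> and \<open>y'\<close>.\<close>

lemma path_component_of_mult:
  assumes "path_component_of T x x'" "path_component_of T y y'"
  shows "path_component_of T (x \<otimes> y) (x' \<otimes> y')"
  using path_component_of_continuous_image[OF right_cont, of y x x']
    path_component_of_continuous_image[OF left_cont, of x' y y'] assms
    path_component_of_in[OF assms(1)] path_component_of_in[OF assms(2)]
  by (blast intro: path_component_of_trans)

lemma carrier_pi0_group: "carrier (pi0_group G T) = cls ` carrier G"
  by (auto simp: pi0_group_def path_components_of_def topspace_eq)

lemma one_pi0_group: "\<one>\<^bsub>pi0_group G T\<^esub> = cls \<one>"
  by (simp add: pi0_group_def)

text \<open>All products of representatives lie in one path component, so the union in
  \<open>pi0_group\<close> is a union of copies of a single class. It is not empty, since the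
  classes contain \<open>x\<close> and \<open>y\<close>.\<close>

lemma mult_pi0_group:
  assumes "x \<in> carrier G" "y \<in> carrier G"
  shows "cls x \<otimes>\<^bsub>pi0_group G T\<^esub> cls y = cls (x \<otimes> y)"
proof -
  have "cls (x' \<otimes> y') = cls (x \<otimes> y)" if "x' \<in> cls x" "y' \<in> cls y" for x' y'
    using path_component_of_mult[of x x' y y'] that cls_eq_iff[of "x \<otimes> y" "x' \<otimes> y'"] assms by auto
  then have "(\<Union>x'\<in>cls x. \<Union>y'\<in>cls y. cls (x' \<otimes> y')) = (\<Union>x'\<in>cls x. \<Union>y'\<in>cls y. cls (x \<otimes> y))"
    by (intro SUP_cong refl) auto
  also have "\<dots> = cls (x \<otimes> y)"
    using cls_self assms by blast
  finally show ?thesis by (simp add: pi0_group_def)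
qed

lemma group_pi0_group: "group (pi0_group G T)"
proof (rule groupI)
  show "\<exists>y\<in>carrier (pi0_group G T). y \<otimes>\<^bsub>pi0_group G T\<^esub> x = \<one>\<^bsub>pi0_group G T\<^esub>"
    if "x \<in> carrier (pi0_group G T)" for x
    using that unfolding carrier_pi0_group one_pi0_group
    by (auto simp: mult_pi0_group intro!: bexI[of _ "inv _"])
qed (auto simp: carrier_pi0_group one_pi0_group mult_pi0_group m_assoc)

lemma subgroup_cls_one: "subgroup (cls \<one>) G"
proof (rule subgroupI)
  show "cls \<one> \<subseteq> carrier G" using path_component_of_in by auto
  show "cls \<one> \<noteq> {}" using cls_self by blast
  show "inv a \<in> cls \<one>" if "a \<in> cls \<one>" for a
  proof -
    have a: "path_component_of T \<one> a" "a \<in> carrier G" using that path_component_of_in by auto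
    \<comment> \<open>Translation by \<open>inv a\<close> turns a path from the unit to
      \<open>a\<close> into one from \<open>inv a\<close> to the unit.\<close>
    have "path_component_of T (inv a \<otimes> \<one>) (inv a \<otimes> a)"
      using a by (intro path_component_of_mult) (auto simp: path_component_of_refl topspace_eq)
    then show ?thesis using a by (simp add: path_component_of_sym)
  qed
  show "a \<otimes> b \<in> cls \<one>" if "a \<in> cls \<one>" "b \<in> cls \<one>" for a b
    using that path_component_of_mult[of \<one> a \<one> b] by simp
qed

end

lemma pi0_map_hom:
  assumes "pi0_grp G S" "pi0_grp H T" "f \<in> hom G H" "continuous_map S T f"
  shows pi0_map_cls: "\<And>x. x \<in> carrier G \<Longrightarrow>
      pi0_map T f (path_component_of_set S x) = path_component_of_set T (f x)"
    and pi0_map_in_hom: "pi0_map T f \<in> hom (pi0_group G S) (pi0_group H T)"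
proof -
  interpret G: pi0_grp G S by fact
  interpret H: pi0_grp H T by fact
  have fc: "f x \<in> carrier H" if "x \<in> carrier G" for x
    using assms(3) that by (auto simp: hom_def)
  show *: "pi0_map T f (G.cls x) = H.cls (f x)" if "x \<in> carrier G" for x
  proof -
    have "H.cls (f y) = H.cls (f x)" if "y \<in> G.cls x" for y
      using path_component_of_continuous_image[OF assms(4), of x y] that
        H.cls_eq_iff[OF fc[OF \<open>x \<in> carrier G\<close>], of "f y"] by auto
    then show ?thesis
      unfolding pi0_map_def using G.cls_self[OF that] by blast
  qed
  show "pi0_map T f \<in> hom (pi0_group G S) (pi0_group H T)"
    unfolding hom_def using hom_mult[OF assms(3)]
    by (auto simp: G.carrier_pi0_group H.carrier_pi0_group G.mult_pi0_group H.mult_pi0_group * fc)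
qed

section \<open>The compact-open topology\<close>

lemma topspace_compact_open:
  "topspace (compact_open_topology X Y) = {f \<in> extensional (topspace X). continuous_map X Y f}"
proof -
  \<comment> \<open>The subbasic set given by the empty compact set and the empty open set is the
    whole function space.\<close>
  have "compactin X {}" "openin Y {}" by simp_all
  then show ?thesis unfolding compact_open_topology_def topology_generated_by_topspace by auto
qed

text \<open>Only translations are shown continuous; joint continuity of composition would need local
  compactness and is not needed for the group structure on path components.\<close>

lemma continuous_map_compact_open_postcompose:
  assumes "continuous_map Y Z h"
  shows "continuous_map (compact_open_topology X Y) (compact_open_topology X Z) (compose (topspace X) h)"
  unfolding compact_open_topology_def[of X Z]
proof (rule continuous_on_generated_topo)
  let ?T = "compact_open_topology X Y"
  have cm: "continuous_map X Z (compose (topspace X) h f)" if "continuous_map X Y f" for f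
    using continuous_map_compose[OF that assms]
    by (rule continuous_map_eq) (simp add: compose_def)
  show "compose (topspace X) h ` topspace ?T
      \<subseteq> \<Union> {{f \<in> extensional (topspace X). continuous_map X Z f \<and> f ` K \<subseteq> V} |K V.
          compactin X K \<and> openin Z V}"
    using topspace_compact_open[of X Z] cm
    unfolding compact_open_topology_def[of X Z] topology_generated_by_topspace topspace_compact_open
    by auto
  fix U assume "U \<in> {{f \<in> extensional (topspace X). continuous_map X Z f \<and> f ` K \<subseteq> V} |K V.
          compactin X K \<and> openin Z V}"
  then obtain K V where U: "U = {f \<in> extensional (topspace X). continuous_map X Z f \<and> f ` K \<subseteq> V}"
    and K: "compactin X K" and V: "openin Z V" by blast
  let ?V = "{y \<in> topspace Y. h y \<in> V}"
  have KX: "K \<subseteq> topspace X" using K compactin_subset_topspace by blast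
  have "compose (topspace X) h -` U \<inter> topspace ?T
      = {f \<in> extensional (topspace X). continuous_map X Y f \<and> f ` K \<subseteq> ?V}"
    using KX cm continuous_map_image_subset_topspace[of X Y]
    unfolding topspace_compact_open U by (fastforce simp: compose_def image_subset_iff)
  moreover have "openin ?T {f \<in> extensional (topspace X). continuous_map X Y f \<and> f ` K \<subseteq> ?V}"
    unfolding compact_open_topology_def
    by (rule topology_generated_by_Basis) (use K openin_continuous_map_preimage[OF assms V] in blast)
  ultimately show "openin ?T (compose (topspace X) h -` U \<inter> topspace ?T)" by simp
qed

text \<open>Here the compact set is transported: the composite sends \<open>K\<close> into
  \<open>V\<close> iff \<open>f\<close> sends the compact image of \<open>K\<close> under
  \<open>h\<close> into \<open>V\<close>.\<close>

lemma continuous_map_compact_open_precompose: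
  assumes "continuous_map X Y h"
  shows "continuous_map (compact_open_topology Y Z) (compact_open_topology X Z)
    (\<lambda>f. compose (topspace X) f h)"
  unfolding compact_open_topology_def[of X Z]
proof (rule continuous_on_generated_topo)
  let ?T = "compact_open_topology Y Z"
  have cm: "continuous_map X Z (compose (topspace X) f h)" if "continuous_map Y Z f" for f
    using continuous_map_compose[OF assms that]
    by (rule continuous_map_eq) (simp add: compose_def)
  show "(\<lambda>f. compose (topspace X) f h) ` topspace ?T
      \<subseteq> \<Union> {{f \<in> extensional (topspace X). continuous_map X Z f \<and> f ` K \<subseteq> V} |K V.
          compactin X K \<and> openin Z V}"
    using topspace_compact_open[of X Z] cm
    unfolding compact_open_topology_def[of X Z] topology_generated_by_topspace topspace_compact_open
    by auto
  fix U assume "U \<in> {{f \<in> extensional (topspace X). continuous_map X Z f \<and> f ` K \<subseteq> V} |K V.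
          compactin X K \<and> openin Z V}"
  then obtain K V where U: "U = {f \<in> extensional (topspace X). continuous_map X Z f \<and> f ` K \<subseteq> V}"
    and K: "compactin X K" and V: "openin Z V" by blast
  have KX: "K \<subseteq> topspace X" using K compactin_subset_topspace by blast
  have "(\<lambda>f. compose (topspace X) f h) -` U \<inter> topspace ?T
      = {f \<in> extensional (topspace Y). continuous_map Y Z f \<and> f ` (h ` K) \<subseteq> V}"
    using KX cm unfolding topspace_compact_open U
    by (fastforce simp: compose_def image_subset_iff)
  moreover have "openin ?T {f \<in> extensional (topspace Y). continuous_map Y Z f \<and> f ` (h ` K) \<subseteq> V}"
    unfolding compact_open_topology_def
    by (rule topology_generated_by_Basis) (use V image_compactin[OF K assms] in blast)
  ultimately show "openin ?T ((\<lambda>f. compose (topspace X) f h) -` U \<inter> topspace ?T)" by simp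
qed

text \<open>The parameters for which some point of \<open>K\<close> leaves \<open>V\<close> form the
  projection of a closed set along the compact factor \<open>K\<close>, hence a closed set. This
  turns isotopies, jointly continuous in time and point, into paths of maps.\<close>

lemma continuous_map_compact_open_curry:
  assumes "continuous_map (prod_topology I X) Y (\<lambda>(t, x). H t x)"
    and "\<And>t. t \<in> topspace I \<Longrightarrow> H t \<in> extensional (topspace X)"
  shows "continuous_map I (compact_open_topology X Y) H"
  unfolding compact_open_topology_def
proof (rule continuous_on_generated_topo)
  have cm: "continuous_map X Y (H t)" if "t \<in> topspace I" for t
  proof -
    have "continuous_map X (prod_topology I X) (\<lambda>x. (t, x))"
      using that by (simp add: continuous_map_paired)
    from continuous_map_compose[OF this assms(1)] show ?thesis by (simp add: o_def)
  qed
  show "H ` topspace I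
      \<subseteq> \<Union> {{f \<in> extensional (topspace X). continuous_map X Y f \<and> f ` K \<subseteq> V} |K V.
          compactin X K \<and> openin Y V}"
    using topspace_compact_open[of X Y] cm assms(2)
    unfolding compact_open_topology_def[of X Y] topology_generated_by_topspace by auto
  fix U assume "U \<in> {{f \<in> extensional (topspace X). continuous_map X Y f \<and> f ` K \<subseteq> V} |K V.
          compactin X K \<and> openin Y V}"
  then obtain K V where U: "U = {f \<in> extensional (topspace X). continuous_map X Y f \<and> f ` K \<subseteq> V}"
    and K: "compactin X K" and V: "openin Y V" by blast
  have KX: "K \<subseteq> topspace X" using K compactin_subset_topspace by blast
  let ?P = "prod_topology I (subtopology X K)"
  have "continuous_map ?P Y (\<lambda>(t, x). H t x)"
    using assms(1) continuous_map_from_subtopology[of _ Y _ "UNIV \<times> K"]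
    by (metis prod_topology_subtopology(2) continuous_map_from_subtopology)
  moreover have "closedin Y (topspace Y - V)" using V by blast
  ultimately have "closedin ?P {z \<in> topspace ?P. (\<lambda>(t, x). H t x) z \<in> topspace Y - V}"
    by (rule closedin_continuous_map_preimage)
  moreover have "closed_map ?P I fst"
    by (rule closed_map_fst) (use K compactin_subspace in blast)
  ultimately have "closedin I (fst ` {z \<in> topspace ?P. (\<lambda>(t, x). H t x) z \<in> topspace Y - V})"
    by (simp add: closed_map_def)
  then have "openin I (topspace I - fst ` {z \<in> topspace ?P. (\<lambda>(t, x). H t x) z \<in> topspace Y - V})"
    by blast
  moreover have "topspace I - fst ` {z \<in> topspace ?P. (\<lambda>(t, x). H t x) z \<in> topspace Y - V}
      = H -` U \<inter> topspace I"
  proof -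
    have "H t x \<in> topspace Y" if "t \<in> topspace I" "x \<in> K" for t x
      using continuous_map_image_subset_topspace[OF cm[OF that(1)]] that KX by blast
    then have "t \<in> fst ` {z \<in> topspace ?P. (\<lambda>(t, x). H t x) z \<in> topspace Y - V} \<longleftrightarrow> \<not> H t ` K \<subseteq> V"
      if "t \<in> topspace I" for t
      using that KX by (force simp: image_iff)
    then show ?thesis using cm assms(2) unfolding U by auto
  qed
  ultimately show "openin I (H -` U \<inter> topspace I)" by simp
qed

section \<open>Smooth maps and diffeomorphisms of a surface\<close>

lemma smooth_onE:
  assumes "smooth_on S f" "x \<in> S"
  obtains W g where "open W" "x \<in> W" "\<And>n. Ck_on n W g" "\<And>y. y \<in> W \<Longrightarrow> y \<in> S \<Longrightarrow> g y = f y"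
  using assms(1)[unfolded smooth_on_def, rule_format, OF assms(2)] by auto

lemma smooth_on_subset:
  assumes "smooth_on S f" "T \<subseteq> S"
  shows "smooth_on T f"
  unfolding smooth_on_def
proof
  fix x assume "x \<in> T"
  then have "x \<in> S" using assms(2) by blast
  from assms(1) this obtain W g where "open W" "x \<in> W" "\<And>n. Ck_on n W g"
      "\<And>y. y \<in> W \<Longrightarrow> y \<in> S \<Longrightarrow> g y = f y"
    by (rule smooth_onE) blast
  then show "\<exists>W g. open W \<and> x \<in> W \<and> (\<forall>n. Ck_on n W g) \<and> (\<forall>y\<in>W \<inter> T. g y = f y)"
    using assms(2) by blast
qed

lemma smooth_on_cong:
  assumes "\<And>x. x \<in> S \<Longrightarrow> f x = g x"
  shows "smooth_on S f \<longleftrightarrow> smooth_on S g"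
  using assms unfolding smooth_on_def by (simp cong: conj_cong)

lemma smooth_on_open: "(\<And>n. Ck_on n W f) \<Longrightarrow> open W \<Longrightarrow> smooth_on W f"
  unfolding smooth_on_def by blast

lemma smooth_on_local:
  assumes "\<And>x. x \<in> S \<Longrightarrow> \<exists>T. openin (top_of_set S) T \<and> x \<in> T \<and> smooth_on T f"
  shows "smooth_on S f"
  unfolding smooth_on_def
proof
  fix x assume "x \<in> S"
  then obtain T where T: "openin (top_of_set S) T" "x \<in> T" "smooth_on T f" using assms by blast
  from T(1) obtain O' where O': "open O'" "T = S \<inter> O'" by (auto simp: openin_open)
  from T(3,2) obtain W g where W: "open W" "x \<in> W" "\<And>n. Ck_on n W g"
      "\<And>y. y \<in> W \<Longrightarrow> y \<in> T \<Longrightarrow> g y = f y"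
    by (rule smooth_onE) blast
  have "open (W \<inter> O')" "x \<in> W \<inter> O'" "\<forall>n. Ck_on n (W \<inter> O') g" "\<forall>y\<in>W \<inter> O' \<inter> S. g y = f y"
    using W O' T(2) Ck_on_subset[OF W(3)] by auto
  then show "\<exists>W g. open W \<and> x \<in> W \<and> (\<forall>n. Ck_on n W g) \<and> (\<forall>y\<in>W \<inter> S. g y = f y)" by blast
qed

lemma smooth_on_compose:
  fixes f :: "'a::real_normed_vector \<Rightarrow> 'b::euclidean_space"
    and g :: "'b \<Rightarrow> 'c::real_normed_vector"
  assumes "smooth_on S f" "smooth_on T g" "f ` S \<subseteq> T"
  shows "smooth_on S (\<lambda>x. g (f x))"
  unfolding smooth_on_def
proof
  fix x assume x: "x \<in> S"
  then have fx: "f x \<in> T" using assms(3) by blast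
  from assms(1) x obtain W F where W: "open W" "x \<in> W" "\<And>n. Ck_on n W F"
      "\<And>y. y \<in> W \<Longrightarrow> y \<in> S \<Longrightarrow> F y = f y"
    by (rule smooth_onE) blast
  from assms(2) fx obtain V G where V: "open V" "f x \<in> V" "\<And>n. Ck_on n V G"
      "\<And>y. y \<in> V \<Longrightarrow> y \<in> T \<Longrightarrow> G y = g y"
    by (rule smooth_onE) blast
  \<comment> \<open>The local extension \<open>F\<close> may leave \<open>V\<close>, so the
    composite extension lives on a preimage.\<close>
  have op: "open (W \<inter> F -` V)"
    using continuous_open_preimage[OF Ck_on_imp_continuous_on[OF W(3)[of 0]] W(1) V(1)] .
  have "Ck_on n (W \<inter> F -` V) (\<lambda>x. G (F x))" for n
    by (rule Ck_on_compose[OF op V(1) _ Ck_on_subset[OF W(3)] V(3)]) auto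
  moreover have "x \<in> W \<inter> F -` V" using W V x by auto
  moreover have "G (F y) = g (f y)" if "y \<in> W \<inter> F -` V \<inter> S" for y
    using that W(4) V(4) assms(3) by auto
  ultimately show "\<exists>W h. open W \<and> x \<in> W \<and> (\<forall>n. Ck_on n W h) \<and> (\<forall>y\<in>W \<inter> S. h y = g (f y))"
    using op by blast
qed

lemma mult_BijGroup: "f \<in> Bij S \<Longrightarrow> g \<in> Bij S \<Longrightarrow> f \<otimes>\<^bsub>BijGroup S\<^esub> g = compose S f g"
  by (simp add: BijGroup_def)

section \<open>Charts and smooth self-maps\<close>

locale surface =
  fixes X :: "'a topology" and A :: "'a chart set"
  assumes smooth_surface: "smooth_surface X A"
begin

lemma chart:
  assumes "(U, \<phi>) \<in> A"
  shows openin_chart: "openin X U"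
    and chart_subset: "U \<subseteq> topspace X"
    and chart_homeo: "homeomorphic_map (subtopology X U) (top_of_set (\<phi> ` U)) \<phi>"
    and chart_image: "openin (top_of_set half_plane) (\<phi> ` U)"
proof -
  have "is_chart X (U, \<phi>)" using assms smooth_surface by (auto simp: smooth_surface_def smooth_atlas_def)
  then show "openin X U" "homeomorphic_map (subtopology X U) (top_of_set (\<phi> ` U)) \<phi>"
    "openin (top_of_set half_plane) (\<phi> ` U)" by (auto simp: is_chart_def)
  then show "U \<subseteq> topspace X" using openin_subset by blast
qed

lemma inj_on_chart: "(U, \<phi>) \<in> A \<Longrightarrow> inj_on \<phi> U"
  using homeomorphic_imp_injective_map[OF chart_homeo] chart_subset by (simp add: Int_absorb1)

lemma inv_chart [simp]: "(U, \<phi>) \<in> A \<Longrightarrow> p \<in> U \<Longrightarrow> inv_into U \<phi> (\<phi> p) = p"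
  by (simp add: inj_on_chart)

lemma chart_cover: "p \<in> topspace X \<Longrightarrow> \<exists>U \<phi>. (U, \<phi>) \<in> A \<and> p \<in> U"
  using smooth_surface by (force simp: smooth_surface_def smooth_atlas_def)

lemma transition_smooth:
  "(U, \<phi>) \<in> A \<Longrightarrow> (V, \<psi>) \<in> A \<Longrightarrow> smooth_on (\<phi> ` (U \<inter> V)) (\<lambda>x. \<psi> (inv_into U \<phi> x))"
  using smooth_surface by (fastforce simp: smooth_surface_def smooth_atlas_def o_def)

lemma continuous_chart: "(U, \<phi>) \<in> A \<Longrightarrow> continuous_map (subtopology X U) euclidean \<phi>"
  using homeomorphic_imp_continuous_map[OF chart_homeo] by (simp add: continuous_map_in_subtopology)

lemma continuous_inv_chart:
  assumes "(U, \<phi>) \<in> A"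
  shows "continuous_map (top_of_set (\<phi> ` U)) X (inv_into U \<phi>)"
proof -
  obtain g where g: "homeomorphic_maps (subtopology X U) (top_of_set (\<phi> ` U)) \<phi> g"
    using chart_homeo[OF assms] homeomorphic_map_maps by blast
  have "continuous_map (top_of_set (\<phi> ` U)) X g"
    using g by (simp add: homeomorphic_maps_def continuous_map_in_subtopology)
  moreover have "g x = inv_into U \<phi> x" if "x \<in> \<phi> ` U" for x
    using g that chart_subset[OF assms] assms by (auto simp: homeomorphic_maps_def)
  ultimately show ?thesis by (rule continuous_map_eq) auto
qed

lemma openin_chart_image:
  assumes "(U, \<phi>) \<in> A" "openin X N" "N \<subseteq> U"
  shows "openin (top_of_set half_plane) (\<phi> ` N)"
proof -
  have "openin (subtopology X U) N" using assms openin_subset_topspace_eq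
    by (metis inf.absorb_iff1 openin_subtopology_Int)
  then have "openin (top_of_set (\<phi> ` U)) (\<phi> ` N)"
    using homeomorphic_imp_open_map[OF chart_homeo[OF assms(1)]] by (simp add: open_map_def)
  then show ?thesis using chart_image[OF assms(1)] openin_trans by blast
qed

lemma openin_chart_preimage:
  assumes "(U, \<phi>) \<in> A" "open O'"
  shows "openin X {p \<in> U. \<phi> p \<in> O'}"
proof -
  have "openin (subtopology X U) {p \<in> topspace (subtopology X U). \<phi> p \<in> O'}"
    using openin_continuous_map_preimage[OF continuous_chart[OF assms(1)]] assms(2) by simp
  moreover have "{p \<in> topspace (subtopology X U). \<phi> p \<in> O'} = {p \<in> U. \<phi> p \<in> O'}"
    using chart_subset[OF assms(1)] by auto
  ultimately show ?thesis using openin_trans_full openin_chart[OF assms(1)] by metis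
qed

lemma openin_chart_Collect:
  assumes "continuous_map X X f" "(U, \<phi>) \<in> A" "(V, \<psi>) \<in> A"
  shows "openin X {x \<in> U. f x \<in> V}"
proof -
  have "{x \<in> U. f x \<in> V} = U \<inter> {x \<in> topspace X. f x \<in> V}" using chart_subset assms by blast
  then show ?thesis
    using openin_continuous_map_preimage[OF assms(1) openin_chart[OF assms(3)]] openin_chart[OF assms(2)]
    by auto
qed

text \<open>Smoothness is defined through all pairs of charts. One pair around each point is enough,
  because any other coordinate expression is locally this one framed by two transition maps.\<close>

lemma smooth_map_localI:
  assumes f: "continuous_map X X f"
    and loc: "\<And>p. p \<in> topspace X \<Longrightarrow> \<exists>U \<phi> V \<psi> N. (U, \<phi>) \<in> A \<and> (V, \<psi>) \<in> A \<and> openin X N \<and>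
      p \<in> N \<and> N \<subseteq> U \<and> f ` N \<subseteq> V \<and> smooth_on (\<phi> ` N) (\<lambda>x. \<psi> (f (inv_into U \<phi> x)))"
  shows "smooth_map X A X A f"
  unfolding smooth_map_def
proof (intro conjI f ballI, clarify)
  fix U' \<phi>' V' \<psi>' assume c': "(U', \<phi>') \<in> A" "(V', \<psi>') \<in> A"
  let ?M = "{x \<in> U'. f x \<in> V'}"
  show "smooth_on (\<phi>' ` ?M) (\<psi>' \<circ> f \<circ> inv_into U' \<phi>')"
  proof (rule smooth_on_local)
    fix x assume "x \<in> \<phi>' ` ?M"
    then obtain p where p: "p \<in> U'" "f p \<in> V'" "x = \<phi>' p" by blast
    then have "p \<in> topspace X" using chart_subset[OF c'(1)] by blast
    then obtain U \<phi> V \<psi> N where c: "(U, \<phi>) \<in> A" "(V, \<psi>) \<in> A" and N: "openin X N" "p \<in> N" "N \<subseteq> U"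
      "f ` N \<subseteq> V" and sm: "smooth_on (\<phi> ` N) (\<lambda>x. \<psi> (f (inv_into U \<phi> x)))"
      using loc by blast
    let ?N = "N \<inter> ?M"
    have oN: "openin X ?N" using openin_chart_Collect[OF f c'] N(1) by blast
    have "openin (top_of_set half_plane) (\<phi>' ` ?N)"
      by (rule openin_chart_image[OF c'(1) oN]) auto
    moreover have "\<phi>' ` ?M \<subseteq> half_plane"
      using chart_image[OF c'(1)] openin_imp_subset by fastforce
    ultimately have "openin (top_of_set (\<phi>' ` ?M)) (\<phi>' ` ?N)"
      using openin_subset_trans[of half_plane "\<phi>' ` ?N" "\<phi>' ` ?M"] by auto
    moreover have "x \<in> \<phi>' ` ?N" using p N by blast
    moreover have "smooth_on (\<phi>' ` ?N) (\<psi>' \<circ> f \<circ> inv_into U' \<phi>')"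
    proof -
      have 1: "smooth_on (\<phi>' ` ?N) (\<lambda>x. \<phi> (inv_into U' \<phi>' x))"
        by (rule smooth_on_subset[OF transition_smooth[OF c'(1) c(1)]]) (use N in auto)
      have 2: "smooth_on (\<phi>' ` ?N) (\<lambda>x. \<psi> (f (inv_into U \<phi> (\<phi> (inv_into U' \<phi>' x)))))"
        by (rule smooth_on_compose[OF 1 sm]) (use c' in auto)
      have "smooth_on (\<phi>' ` ?N) (\<lambda>x. \<psi>' (inv_into V \<psi> (\<psi> (f (inv_into U \<phi> (\<phi> (inv_into U' \<phi>' x)))))))"
        by (rule smooth_on_compose[OF 2 transition_smooth[OF c(2) c'(2)]])
          (use c c' N in \<open>auto simp: subset_iff image_subset_iff intro!: imageI\<close>)
      then show ?thesis
        by (subst smooth_on_cong) (use c c' N in \<open>auto simp: subset_iff\<close>)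
    qed
    ultimately show "\<exists>T. openin (top_of_set (\<phi>' ` ?M)) T \<and> x \<in> T \<and> smooth_on T (\<psi>' \<circ> f \<circ> inv_into U' \<phi>')"
      by blast
  qed
qed

lemma smooth_map_charts:
  assumes "smooth_map X A X A f" "(U, \<phi>) \<in> A" "(V, \<psi>) \<in> A"
  shows "smooth_on (\<phi> ` {x \<in> U. f x \<in> V}) (\<lambda>x. \<psi> (f (inv_into U \<phi> x)))"
  using assms by (fastforce simp: smooth_map_def o_def)

lemma smooth_map_continuous: "smooth_map X A X A f \<Longrightarrow> continuous_map X X f"
  by (simp add: smooth_map_def)

lemma smooth_map_compose:
  assumes "smooth_map X A X A f" "smooth_map X A X A g"
  shows "smooth_map X A X A (\<lambda>x. g (f x))"
proof (rule smooth_map_localI)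
  have f: "continuous_map X X f" and g: "continuous_map X X g" using assms smooth_map_continuous by auto
  show gf: "continuous_map X X (\<lambda>x. g (f x))"
    using continuous_map_compose[OF f g] by (simp add: o_def)
  fix p assume p: "p \<in> topspace X"
  then have fp: "f p \<in> topspace X" using f continuous_map_image_subset_topspace by blast
  then have gp: "g (f p) \<in> topspace X" using g continuous_map_image_subset_topspace by blast
  obtain U \<phi> where U: "(U, \<phi>) \<in> A" "p \<in> U" using chart_cover[OF p] by blast
  obtain V \<psi> where V: "(V, \<psi>) \<in> A" "f p \<in> V" using chart_cover[OF fp] by blast
  obtain W \<theta> where W: "(W, \<theta>) \<in> A" "g (f p) \<in> W" using chart_cover[OF gp] by blast
  \<comment> \<open>The neighbourhood is cut down so that the composite passes through the middle
    chart \<open>V\<close> and ends in \<open>W\<close>.\<close>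
  let ?N = "{x \<in> U. f x \<in> V} \<inter> {x \<in> U. g (f x) \<in> W}"
  have "openin X ?N"
    using openin_chart_Collect[OF f U(1) V(1)] openin_chart_Collect[OF gf U(1) W(1)] by blast
  moreover have "smooth_on (\<phi> ` ?N) (\<lambda>x. \<theta> (g (f (inv_into U \<phi> x))))"
  proof -
    have 1: "smooth_on (\<phi> ` ?N) (\<lambda>x. \<psi> (f (inv_into U \<phi> x)))"
      by (rule smooth_on_subset[OF smooth_map_charts[OF assms(1) U(1) V(1)]]) auto
    have "smooth_on (\<phi> ` ?N) (\<lambda>x. \<theta> (g (inv_into V \<psi> (\<psi> (f (inv_into U \<phi> x))))))"
      by (rule smooth_on_compose[OF 1 smooth_map_charts[OF assms(2) V(1) W(1)]]) (use U in auto)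
    then show ?thesis by (subst smooth_on_cong) (use U V in auto)
  qed
  ultimately show "\<exists>U \<phi> V \<psi> N. (U, \<phi>) \<in> A \<and> (V, \<psi>) \<in> A \<and> openin X N \<and>
      p \<in> N \<and> N \<subseteq> U \<and> (\<lambda>x. g (f x)) ` N \<subseteq> V \<and> smooth_on (\<phi> ` N) (\<lambda>x. \<psi> (g (f (inv_into U \<phi> x))))"
    using U V W by (intro exI[of _ U] exI[of _ \<phi>] exI[of _ W] exI[of _ \<theta>] exI[of _ ?N]) auto
qed

lemma smooth_map_cong:
  assumes "smooth_map X A X A f" "\<And>x. x \<in> topspace X \<Longrightarrow> f x = g x"
  shows "smooth_map X A X A g"
  unfolding smooth_map_def
proof (intro conjI ballI, goal_cases)
  case 1
  show ?case using smooth_map_continuous[OF assms(1)] assms(2) by (rule continuous_map_eq)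
next
  case (2 c)
  show ?case
  proof (clarsimp split: prod.splits)
    fix U \<phi> V \<psi> assume c: "c = (U, \<phi>)" "(V, \<psi>) \<in> A"
    with 2 have U: "(U, \<phi>) \<in> A" by simp
    then have eq: "f x = g x" if "x \<in> U" for x using that chart_subset assms(2) by blast
    then have "{x \<in> U. f x \<in> V} = {x \<in> U. g x \<in> V}" by auto
    with smooth_map_charts[OF assms(1) U c(2)]
    have "smooth_on (\<phi> ` {x \<in> U. g x \<in> V}) (\<lambda>x. \<psi> (f (inv_into U \<phi> x)))" by simp
    then show "smooth_on (\<phi> ` {x \<in> U. g x \<in> V}) (\<psi> \<circ> g \<circ> inv_into U \<phi>)"
      by (subst smooth_on_cong) (use U eq in auto)
  qed
qed

lemma smooth_map_id: "smooth_map X A X A (\<lambda>x. x)"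
proof (rule smooth_map_localI)
  fix p assume "p \<in> topspace X"
  then obtain U \<phi> where U: "(U, \<phi>) \<in> A" "p \<in> U" using chart_cover by blast
  have "smooth_on (\<phi> ` U) (\<lambda>x. \<phi> (inv_into U \<phi> x))"
    using transition_smooth[OF U(1) U(1)] by simp
  with U openin_chart[OF U(1)]
  show "\<exists>U \<phi> V \<psi> N. (U, \<phi>) \<in> A \<and> (V, \<psi>) \<in> A \<and> openin X N \<and>
      p \<in> N \<and> N \<subseteq> U \<and> (\<lambda>x. x) ` N \<subseteq> V \<and> smooth_on (\<phi> ` N) (\<lambda>x. \<psi> (inv_into U \<phi> x))"
    by (intro exI[of _ U] exI[of _ \<phi>]) auto
qed (rule continuous_map_id[unfolded id_def])

section \<open>Diffeomorphism groups\<close>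

lemma DiffD:
  assumes "f \<in> Diff X A"
  shows "f \<in> Bij (topspace X)" "continuous_map X X f" "f \<in> extensional (topspace X)"
    "bij_betw f (topspace X) (topspace X)"
  using assms by (auto simp: Diff_def Bij_def smooth_map_def)

text \<open>Diffeomorphisms are built as total functions with an explicit inverse. Restriction makes
  them extensional, and \<open>inv_into\<close> of the restriction agrees with \<open>g\<close> on
  the surface, which is all that \<open>smooth_map\<close> sees.\<close>

lemma DiffI:
  assumes f: "smooth_map X A X A f" and g: "smooth_map X A X A g"
    and gf: "\<And>x. x \<in> topspace X \<Longrightarrow> g (f x) = x" and fg: "\<And>x. x \<in> topspace X \<Longrightarrow> f (g x) = x"
  shows "restrict f (topspace X) \<in> Diff X A"
proof -
  let ?f = "restrict f (topspace X)"
  have fX: "f x \<in> topspace X" and gX: "g x \<in> topspace X" if "x \<in> topspace X" for x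
    using that f g smooth_map_continuous continuous_map_image_subset_topspace by blast+
  have bij: "bij_betw ?f (topspace X) (topspace X)"
    by (rule bij_betw_byWitness[where f' = g]) (auto simp: gf fg fX gX)
  have "inv_into (topspace X) ?f x = g x" if "x \<in> topspace X" for x
    by (rule inv_into_f_eq) (use bij that fg gX in \<open>auto simp: bij_betw_def\<close>)
  then have "smooth_map X A X A (inv_into (topspace X) ?f)"
    using smooth_map_cong[OF g] by simp
  moreover have "smooth_map X A X A ?f" using smooth_map_cong[OF f] by simp
  ultimately show ?thesis using bij by (simp add: Diff_def Bij_def)
qed

lemma subgroup_Diff: "subgroup (Diff X A) (BijGroup (topspace X))"
proof (rule group.subgroupI[OF group_BijGroup])
  show "Diff X A \<subseteq> carrier (BijGroup (topspace X))" by (auto simp: BijGroup_def Diff_def)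
  show "Diff X A \<noteq> {}" using DiffI[OF smooth_map_id smooth_map_id] by blast
  fix f assume f: "f \<in> Diff X A"
  have sf: "smooth_map X A X A f" "smooth_map X A X A (inv_into (topspace X) f)"
    using f by (auto simp: Diff_def)
  have inv: "inv_into (topspace X) f (f x) = x" "f (inv_into (topspace X) f x) = x" if "x \<in> topspace X" for x
    using DiffD(4)[OF f] that by (auto simp: bij_betw_def f_inv_into_f)
  show "inv\<^bsub>BijGroup (topspace X)\<^esub> f \<in> Diff X A"
    unfolding inv_BijGroup[OF DiffD(1)[OF f]] using DiffI[OF sf(2,1)] inv by blast
  fix g assume g: "g \<in> Diff X A"
  have sg: "smooth_map X A X A g" "smooth_map X A X A (inv_into (topspace X) g)"
    using g by (auto simp: Diff_def)
  have invg: "inv_into (topspace X) g (g x) = x" "g (inv_into (topspace X) g x) = x" if "x \<in> topspace X" for x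
    using DiffD(4)[OF g] that by (auto simp: bij_betw_def f_inv_into_f)
  have mem: "g x \<in> topspace X" "inv_into (topspace X) f x \<in> topspace X" if "x \<in> topspace X" for x
    using Bij_imp_funcset[OF DiffD(1)[OF g]] Bij_inv_into_mem[OF DiffD(1)[OF f]] that by auto
  show "f \<otimes>\<^bsub>BijGroup (topspace X)\<^esub> g \<in> Diff X A"
    unfolding mult_BijGroup[OF DiffD(1)[OF f] DiffD(1)[OF g]] compose_def
    by (rule DiffI[OF smooth_map_compose[OF sg(1) sf(1)] smooth_map_compose[OF sf(2) sg(2)]])
      (simp_all add: inv invg mem)
qed

lemma subgroup_Diff_marked:
  assumes "P \<subseteq> topspace X"
  shows "subgroup (Diff_marked X A P) (BijGroup (topspace X))"
proof (rule group.subgroupI[OF group_BijGroup])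
  interpret D: subgroup "Diff X A" "BijGroup (topspace X)" by (rule subgroup_Diff)
  show "Diff_marked X A P \<subseteq> carrier (BijGroup (topspace X))" by (auto simp: BijGroup_def Diff_def Diff_marked_def)
  have "restrict (\<lambda>x. x) (topspace X) ` P = P" using assms by (force simp: image_iff)
  then show "Diff_marked X A P \<noteq> {}" using DiffI[OF smooth_map_id smooth_map_id]
    unfolding Diff_marked_def by blast
  fix f assume f: "f \<in> Diff_marked X A P"
  then have f': "f \<in> Diff X A" "f ` P = P" by (auto simp: Diff_marked_def)
  have "inv_into (topspace X) f ` P = inv_into (topspace X) f ` f ` P" using f' by simp
  also have "\<dots> = P" using inv_into_image_cancel[OF _ assms] DiffD(4)[OF f'(1)] by (auto simp: bij_betw_def)
  finally have "inv_into (topspace X) f ` P = P" .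
  moreover have "restrict (inv_into (topspace X) f) (topspace X) ` P = inv_into (topspace X) f ` P"
    by (rule image_cong) (use assms in auto)
  ultimately have "restrict (inv_into (topspace X) f) (topspace X) ` P = P" by simp
  then show "inv\<^bsub>BijGroup (topspace X)\<^esub> f \<in> Diff_marked X A P"
    using D.m_inv_closed[OF f'(1)] inv_BijGroup[OF DiffD(1)[OF f'(1)]] by (simp add: Diff_marked_def)
  fix g assume g: "g \<in> Diff_marked X A P"
  then have g': "g \<in> Diff X A" "g ` P = P" by (auto simp: Diff_marked_def)
  have "compose (topspace X) f g ` P = f ` g ` P" using assms by (force simp: compose_def image_iff)
  then show "f \<otimes>\<^bsub>BijGroup (topspace X)\<^esub> g \<in> Diff_marked X A P"
    using D.m_closed[OF f'(1) g'(1)] f' g'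
    by (simp add: Diff_marked_def mult_BijGroup[OF DiffD(1)[OF f'(1)] DiffD(1)[OF g'(1)]])
qed

text \<open>Stated for any subgroup, as it is applied to all diffeomorphisms, to those preserving
  the marked set, and to the members of the identity component among the latter.\<close>

lemma pi0_grp_diffeo:
  assumes "subgroup D (BijGroup (topspace X))" "D \<subseteq> Diff X A"
  shows "pi0_grp (diffeo_group X D) (diffeo_topology X D)"
proof -
  let ?G = "BijGroup (topspace X)"
  interpret D: subgroup D ?G by fact
  have grp: "group (diffeo_group X D)"
    unfolding diffeo_group_def by (rule subgroup.subgroup_is_group[OF assms(1) group_BijGroup])
  have top: "topspace (diffeo_topology X D) = D"
    using assms(2) DiffD by (auto simp: diffeo_topology_def topspace_compact_open)
  have mult: "f \<otimes>\<^bsub>diffeo_group X D\<^esub> g = compose (topspace X) f g" if "f \<in> D" "g \<in> D" for f g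
    using mult_BijGroup[of f "topspace X" g] that assms(2) DiffD(1) by (auto simp: diffeo_group_def)
  have closed: "compose (topspace X) f g \<in> D" if "f \<in> D" "g \<in> D" for f g
    using mult[OF that] D.m_closed[OF that] by (simp add: diffeo_group_def)
  show ?thesis
  proof (intro pi0_grp.intro grp pi0_grp_axioms.intro)
    show "topspace (diffeo_topology X D) = carrier (diffeo_group X D)"
      by (simp add: top diffeo_group_def)
    fix f assume "f \<in> carrier (diffeo_group X D)"
    then have f: "f \<in> D" by (simp add: diffeo_group_def)
    then have cf: "continuous_map X X f" using assms(2) DiffD(2) by blast
    have "continuous_map (diffeo_topology X D) (diffeo_topology X D) (compose (topspace X) f)"
      unfolding diffeo_topology_def
      using continuous_map_from_subtopology[OF continuous_map_compact_open_postcompose[OF cf]] closed f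
      by (auto simp: continuous_map_in_subtopology)
    then show "continuous_map (diffeo_topology X D) (diffeo_topology X D) (\<lambda>x. f \<otimes>\<^bsub>diffeo_group X D\<^esub> x)"
      by (rule continuous_map_eq) (simp add: top mult f)
    have "continuous_map (diffeo_topology X D) (diffeo_topology X D) (\<lambda>g. compose (topspace X) g f)"
      unfolding diffeo_topology_def
      using continuous_map_from_subtopology[OF continuous_map_compact_open_precompose[OF cf]] closed f
      by (auto simp: continuous_map_in_subtopology)
    then show "continuous_map (diffeo_topology X D) (diffeo_topology X D) (\<lambda>x. x \<otimes>\<^bsub>diffeo_group X D\<^esub> f)"
      by (rule continuous_map_eq) (simp add: top mult f)
  qed
qed

end

section \<open>Twists\<close>

definition rot90 :: "real^2 \<Rightarrow> real^2" where
  "rot90 d = vector [- (d $ 2), d $ 1]"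

lemma rot90_simps [simp]:
  "rot90 (rot90 d) = - d" "rot90 d \<bullet> rot90 d = d \<bullet> d" "d \<bullet> rot90 d = 0" "rot90 d \<bullet> d = 0"
  "rot90 (x + y) = rot90 x + rot90 y" "rot90 (a *\<^sub>R x) = a *\<^sub>R rot90 x"
  by (simp_all add: rot90_def vec_eq_iff forall_2 inner_vec_def sum_2 vector_2 algebra_simps)

lemma bounded_linear_rot90: "bounded_linear rot90"
  by (simp add: linearI linear_conv_bounded_linear[symmetric])

text \<open>The twist rotates every circle around \<open>c\<close> by an angle depending on its radius and vanishing
  from radius \<open>R\<close> on; being a rotation on each circle, it has an explicit inverse.\<close>

definition twist :: "real^2 \<Rightarrow> real \<Rightarrow> real \<Rightarrow> real^2 \<Rightarrow> real^2" where
  "twist c R s x = (let t = s * bump 0 (R\<^sup>2 - (x - c) \<bullet> (x - c))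
     in c + cos t *\<^sub>R (x - c) + sin t *\<^sub>R rot90 (x - c))"

text \<open>The vectors \<open>d\<close> and \<open>rot90 d\<close> are orthogonal and equally long,
  so the claim is cos^2 + sin^2 = 1.\<close>

lemma twist_radius: "(twist c R s x - c) \<bullet> (twist c R s x - c) = (x - c) \<bullet> (x - c)"
proof -
  define d where "d = x - c"
  have "(a *\<^sub>R d + b *\<^sub>R rot90 d) \<bullet> (a *\<^sub>R d + b *\<^sub>R rot90 d) = (a * a + b * b) * (d \<bullet> d)" for a b
    by (simp add: inner_add_left inner_add_right algebra_simps)
  then show ?thesis by (simp add: twist_def Let_def d_def[symmetric] add.assoc)
qed

text \<open>The image lies on the same circle, so the second twist turns by the same angle with the
  opposite sign.\<close>

lemma twist_inverse [simp]: "twist c R (- s) (twist c R s x) = x"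
proof -
  define d where "d = x - c"
  define t where "t = s * bump 0 (R\<^sup>2 - d \<bullet> d)"
  define e where "e = twist c R s x - c"
  have e: "e = cos t *\<^sub>R d + sin t *\<^sub>R rot90 d"
    by (simp add: e_def twist_def Let_def t_def d_def)
  have "twist c R (- s) (twist c R s x) = c + cos t *\<^sub>R e - sin t *\<^sub>R rot90 e"
    using twist_radius[of c R s x] unfolding twist_def[of c R "- s"] e_def[symmetric]
    by (simp add: Let_def t_def d_def)
  \<comment> \<open>Arbitrary coefficients make the sum of squares appear literally; it then
    simplifies to 1.\<close>
  moreover have "a *\<^sub>R (a *\<^sub>R d + b *\<^sub>R rot90 d) - b *\<^sub>R rot90 (a *\<^sub>R d + b *\<^sub>R rot90 d)
      = (a * a + b * b) *\<^sub>R d" for a b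
    by (simp add: algebra_simps)
  then have "cos t *\<^sub>R e - sin t *\<^sub>R rot90 e = d"
    unfolding e by simp
  ultimately show ?thesis by (simp add: d_def add_diff_eq[symmetric] del: add_diff_eq)
qed

lemma twist_zero [simp]: "twist c R 0 x = x"
  by (simp add: twist_def)

lemma twist_outside: "R > 0 \<Longrightarrow> x \<notin> cball c R \<Longrightarrow> twist c R s x = x"
proof -
  assume R: "R > 0" "x \<notin> cball c R"
  then have "R \<le> norm (x - c)" by (simp add: dist_norm norm_minus_commute)
  then have "R\<^sup>2 \<le> (x - c) \<bullet> (x - c)"
    using R by (metis less_eq_real_def power2_norm_eq_inner power_mono)
  then show ?thesis by (simp add: twist_def bump_def)
qed

lemma twist_in_cball: "x \<in> cball c R \<Longrightarrow> twist c R s x \<in> cball c R"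
proof -
  have "norm (twist c R s x - c) = norm (x - c)"
    by (simp add: norm_eq_sqrt_inner twist_radius)
  then show "x \<in> cball c R \<Longrightarrow> twist c R s x \<in> cball c R" by (simp add: dist_norm norm_minus_commute)
qed

text \<open>Dividing by the bump at the radius of \<open>x\<close> makes the angle there equal to
  pi. With \<open>c\<close> the midpoint of two points, the twist carries one to the other.\<close>

lemma twist_half_turn:
  assumes "norm (x - c) < R"
  shows "twist c R (pi / bump 0 (R\<^sup>2 - (x - c) \<bullet> (x - c))) x = 2 *\<^sub>R c - x"
proof -
  have "(norm (x - c))\<^sup>2 < R\<^sup>2" using assms by (simp add: power_strict_mono)
  then have "bump 0 (R\<^sup>2 - (x - c) \<bullet> (x - c)) \<noteq> 0"
    by (simp add: bump_def power2_norm_eq_inner)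
  then show ?thesis by (simp add: twist_def scaleR_2)
qed

text \<open>The angle is a function of the squared radius, which is polynomial, so the centre is not
  a singular point.\<close>

lemma Ck_on_twist: "Ck_on n UNIV (twist c R s)"
proof -
  have d: "Ck_on n UNIV (\<lambda>x. x - c)"
    by (intro Ck_on_diff Ck_on_linear Ck_on_const open_UNIV bounded_linear_ident)
  have "Ck_on n UNIV (\<lambda>x. R\<^sup>2 - (x - c) \<bullet> (x - c))"
    by (intro Ck_on_diff Ck_on_bilinear[OF _ bounded_bilinear_inner] Ck_on_const d open_UNIV)
  then have "Ck_on n UNIV (\<lambda>x. bump 0 (R\<^sup>2 - (x - c) \<bullet> (x - c)))"
    by (rule Ck_on_compose[OF open_UNIV open_UNIV subset_UNIV _ Ck_on_bump])
  then have t: "Ck_on n UNIV (\<lambda>x. s * bump 0 (R\<^sup>2 - (x - c) \<bullet> (x - c)))"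
    by (rule Ck_on_linear_image[OF open_UNIV bounded_linear_mult_right])
  have "Ck_on n UNIV (\<lambda>x. cos (s * bump 0 (R\<^sup>2 - (x - c) \<bullet> (x - c))))"
    "Ck_on n UNIV (\<lambda>x. sin (s * bump 0 (R\<^sup>2 - (x - c) \<bullet> (x - c))))"
    by (rule Ck_on_compose[OF open_UNIV open_UNIV _ t]; simp add: Ck_on_sin_cos)+
  then show ?thesis unfolding twist_def Let_def
    by (intro Ck_on_add Ck_on_const Ck_on_bilinear[OF _ bounded_bilinear_scaleR]
        Ck_on_linear_image[OF _ bounded_linear_rot90] d open_UNIV)
qed

text \<open>Joint continuity in parameter and point is what makes the twists an isotopy.\<close>

lemma continuous_on_twist: "continuous_on UNIV (\<lambda>z. twist c R (fst z) (snd z))"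
  unfolding twist_def Let_def
  by (intro continuous_intros bounded_linear.continuous_on[OF bounded_linear_rot90]
      continuous_on_compose2[OF Ck_on_imp_continuous_on[OF Ck_on_bump[of 0]]]) auto

section \<open>Twists transplanted to a surface\<close>

context surface
begin

definition surface_twist :: "'a set \<Rightarrow> ('a \<Rightarrow> real^2) \<Rightarrow> real^2 \<Rightarrow> real \<Rightarrow> real \<Rightarrow> 'a \<Rightarrow> 'a" where
  "surface_twist U \<phi> c R s p = (if p \<in> U then inv_into U \<phi> (twist c R s (\<phi> p)) else p)"

context
  fixes U \<phi> c R
  assumes c: "(U, \<phi>) \<in> A" and R: "R > 0" and cball: "cball c R \<subseteq> \<phi> ` U"
begin

text \<open>Points of the closed disc stay in it, and all others are fixed.\<close>

lemma twist_in_chart: "p \<in> U \<Longrightarrow> twist c R s (\<phi> p) \<in> \<phi> ` U"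
  using twist_in_cball[of "\<phi> p" c R s] twist_outside[OF R, of "\<phi> p" c s] cball by fastforce

lemma surface_twist_in: "p \<in> U \<Longrightarrow> surface_twist U \<phi> c R s p \<in> U"
  using twist_in_chart[of p s] by (simp add: surface_twist_def inv_into_into)

lemma chart_surface_twist: "p \<in> U \<Longrightarrow> \<phi> (surface_twist U \<phi> c R s p) = twist c R s (\<phi> p)"
  using twist_in_chart[of p s] by (simp add: surface_twist_def f_inv_into_f)

lemma surface_twist_inverse [simp]: "surface_twist U \<phi> c R (- s) (surface_twist U \<phi> c R s p) = p"
proof (cases "p \<in> U")
  case True
  then show ?thesis
    using chart_surface_twist[OF True] surface_twist_in[OF True]
    by (simp add: surface_twist_def[of U \<phi> c R "- s"] c)
qed (simp add: surface_twist_def)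

lemma surface_twist_zero [simp]: "surface_twist U \<phi> c R 0 p = p"
  by (simp add: surface_twist_def c)

lemma surface_twist_outside: "(p \<in> U \<Longrightarrow> \<phi> p \<notin> cball c R) \<Longrightarrow> surface_twist U \<phi> c R s p = p"
  by (simp add: surface_twist_def twist_outside R c del: mem_cball)

lemma support_subset: "inv_into U \<phi> ` cball c R \<subseteq> U"
proof
  fix p assume "p \<in> inv_into U \<phi> ` cball c R"
  then obtain x where "x \<in> cball c R" "p = inv_into U \<phi> x" by (rule imageE)
  then show "p \<in> U" using cball by (simp add: inv_into_into subsetD del: mem_cball)
qed

text \<open>The support is compact, hence closed by the Hausdorff property; this is why the
  extension of a twist by the identity beyond the chart stays continuous and smooth.\<close>

lemma openin_complement_support: "openin X (topspace X - inv_into U \<phi> ` cball c R)"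
proof -
  have "compactin (top_of_set (\<phi> ` U)) (cball c R)"
    using cball by (simp add: compactin_subtopology)
  then have "compactin X (inv_into U \<phi> ` cball c R)"
    using image_compactin continuous_inv_chart[OF c] by blast
  moreover have "Hausdorff_space X" using smooth_surface by (simp add: smooth_surface_def)
  ultimately show ?thesis using compactin_imp_closedin by blast
qed

lemma surface_twist_off_support:
  "p \<notin> inv_into U \<phi> ` cball c R \<Longrightarrow> surface_twist U \<phi> c R s p = p"
  by (rule surface_twist_outside) (metis c image_eqI inv_chart)

lemma continuous_map_surface_twist:
  "continuous_map (prod_topology euclideanreal X) X (\<lambda>(s, p). surface_twist U \<phi> c R s p)"
    (is "continuous_map ?P X ?g")
\<comment> \<open>The chart and the complement of the support are open and cover the surface; over
  the second set the map is just the projection.\<close>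
proof (rule pasting_lemma[where I = "{U, topspace X - inv_into U \<phi> ` cball c R}"
      and T = "\<lambda>V. UNIV \<times> V" and f = "\<lambda>_. ?g"])
  fix V assume V: "V \<in> {U, topspace X - inv_into U \<phi> ` cball c R}"
  then have "openin X V" using openin_chart[OF c] openin_complement_support by auto
  then show "openin ?P (UNIV \<times> V)" by (simp add: openin_prod_Times_iff)
  have sub: "subtopology ?P (UNIV \<times> V) = prod_topology euclideanreal (subtopology X V)"
    by (simp add: prod_topology_subtopology)
  show "continuous_map (subtopology ?P (UNIV \<times> V)) X ?g"
  proof (cases "V = U")
    case True
    let ?Q = "prod_topology euclideanreal (subtopology X U)"
    have "continuous_map ?Q euclidean (\<lambda>z. \<phi> (snd z))"
      using continuous_map_compose[OF continuous_map_snd continuous_chart[OF c]]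
      by (simp add: o_def)
    then have "continuous_map ?Q (prod_topology euclidean euclidean) (\<lambda>z. (fst z, \<phi> (snd z)))"
      by (intro continuous_map_pairedI continuous_map_fst)
    then have "continuous_map ?Q euclidean (\<lambda>z. (fst z, \<phi> (snd z)))" by simp
    from continuous_map_compose[OF this, of euclidean "\<lambda>z. twist c R (fst z) (snd z)"]
    have "continuous_map ?Q euclidean (\<lambda>z. twist c R (fst z) (\<phi> (snd z)))"
      using continuous_on_twist by (simp add: o_def)
    then have "continuous_map ?Q (top_of_set (\<phi> ` U)) (\<lambda>z. twist c R (fst z) (\<phi> (snd z)))"
      using twist_in_chart by (auto simp: continuous_map_in_subtopology)
    from continuous_map_compose[OF this continuous_inv_chart[OF c]]
    have "continuous_map ?Q X (\<lambda>z. inv_into U \<phi> (twist c R (fst z) (\<phi> (snd z))))"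
      by (simp add: o_def)
    then show ?thesis unfolding sub unfolding True
      by (rule continuous_map_eq) (auto simp: surface_twist_def)
  next
    case False
    then have V': "V = topspace X - inv_into U \<phi> ` cball c R" using V by simp
    have "continuous_map (prod_topology euclideanreal (subtopology X V)) X snd"
      using continuous_map_snd[of euclideanreal "subtopology X V"]
      by (simp add: continuous_map_in_subtopology)
    then show ?thesis unfolding sub
      by (rule continuous_map_eq) (auto simp: V' surface_twist_off_support)
  qed
next
  fix z assume z: "z \<in> topspace ?P"
  have "snd z \<in> U \<or> snd z \<notin> inv_into U \<phi> ` cball c R"
    using support_subset by blast
  then show "\<exists>V. V \<in> {U, topspace X - inv_into U \<phi> ` cball c R} \<and> z \<in> UNIV \<times> V \<and> ?g z = ?g z"
    using z by (cases z) auto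
qed auto

lemma smooth_map_surface_twist: "smooth_map X A X A (surface_twist U \<phi> c R s)"
proof (rule smooth_map_localI)
  have "continuous_map X (prod_topology euclideanreal X) (\<lambda>p. (s, p))"
    by (simp add: continuous_map_paired)
  from continuous_map_compose[OF this continuous_map_surface_twist]
  show "continuous_map X X (surface_twist U \<phi> c R s)" by (simp add: o_def)
  fix p assume p: "p \<in> topspace X"
  show "\<exists>U' \<phi>' V \<psi> N. (U', \<phi>') \<in> A \<and> (V, \<psi>) \<in> A \<and> openin X N \<and> p \<in> N \<and> N \<subseteq> U' \<and>
      surface_twist U \<phi> c R s ` N \<subseteq> V \<and>
      smooth_on (\<phi>' ` N) (\<lambda>x. \<psi> (surface_twist U \<phi> c R s (inv_into U' \<phi>' x)))"
  proof (cases "p \<in> U")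
    case True
    \<comment> \<open>The twist maps \<open>U\<close> into itself, so one chart serves for source
      and target.\<close>
    have "smooth_on (\<phi> ` U) (twist c R s)"
      by (rule smooth_on_subset[OF smooth_on_open[OF Ck_on_twist open_UNIV]]) simp
    then have "smooth_on (\<phi> ` U) (\<lambda>x. \<phi> (surface_twist U \<phi> c R s (inv_into U \<phi> x)))"
      by (subst smooth_on_cong[where g = "twist c R s"]) (auto simp: c chart_surface_twist)
    then show ?thesis
      using True c openin_chart[OF c] surface_twist_in
      by (intro exI[of _ U] exI[of _ \<phi>]) auto
  next
    case False
    obtain V \<psi> where V: "(V, \<psi>) \<in> A" "p \<in> V" using chart_cover[OF p] by blast
    \<comment> \<open>On this neighbourhood of a point outside \<open>U\<close> the map is the
      identity.\<close>
    let ?N = "V \<inter> (topspace X - inv_into U \<phi> ` cball c R)"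
    have "openin X ?N" using openin_chart[OF V(1)] openin_complement_support by blast
    moreover have "p \<in> ?N"
      using False p V(2) support_subset by blast
    moreover have off: "surface_twist U \<phi> c R s q = q" if "q \<in> ?N" for q
      using that surface_twist_off_support by blast
    moreover have "smooth_on (\<psi> ` ?N) (\<lambda>x. \<psi> (surface_twist U \<phi> c R s (inv_into V \<psi> x)))"
    proof -
      have "smooth_on (\<psi> ` ?N) (\<lambda>x. \<psi> (inv_into V \<psi> x))"
        by (rule smooth_on_subset[OF transition_smooth[OF V(1) V(1)]]) auto
      then show ?thesis
        by (subst smooth_on_cong) (auto simp: V off)
    qed
    ultimately show ?thesis
      using V by (intro exI[of _ V] exI[of _ \<psi>] exI[of _ ?N]) auto
  qed
qed

lemma surface_twist_Diff: "restrict (surface_twist U \<phi> c R s) (topspace X) \<in> Diff X A"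
  using surface_twist_inverse[of "- s"]
  by (intro DiffI[OF smooth_map_surface_twist smooth_map_surface_twist[of "- s"]]) auto

text \<open>Scaling the parameter by t in [0,1] gives an isotopy from the identity.\<close>

lemma surface_twist_Diff0: "restrict (surface_twist U \<phi> c R s) (topspace X) \<in> Diff0 X A"
proof -
  define g where "g = (\<lambda>t. restrict (surface_twist U \<phi> c R (t * s)) (topspace X))"
  have "continuous_map (prod_topology (top_of_set {0..1}) X) euclideanreal (\<lambda>z. fst z * s)"
    using continuous_map_fst[of "top_of_set {0..1::real}" X]
    by (intro continuous_map_real_mult) (auto simp: continuous_map_in_subtopology)
  then have "continuous_map (prod_topology (top_of_set {0..1}) X) (prod_topology euclideanreal X)
      (\<lambda>z. (fst z * s, snd z))"
    by (intro continuous_map_pairedI continuous_map_snd)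
  from continuous_map_compose[OF this continuous_map_surface_twist]
  have "continuous_map (prod_topology (top_of_set {0..1}) X) X
      (\<lambda>z. surface_twist U \<phi> c R (fst z * s) (snd z))"
    by (simp add: o_def)
  then have "continuous_map (prod_topology (top_of_set {0..1}) X) X (\<lambda>(t, p). g t p)"
    by (rule continuous_map_eq) (auto simp: g_def)
  then have "continuous_map (top_of_set {0..1}) (compact_open_topology X X) g"
    by (rule continuous_map_compact_open_curry) (unfold g_def, rule restrict_extensional)
  then have "pathin (diffeo_topology X (Diff X A)) g"
    using surface_twist_Diff
    by (auto simp: pathin_def diffeo_topology_def continuous_map_in_subtopology g_def)
  moreover have "g 0 = restrict (\<lambda>x. x) (topspace X)"
    "g 1 = restrict (surface_twist U \<phi> c R s) (topspace X)"
    by (simp_all add: g_def restrict_def fun_eq_iff)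
  ultimately show ?thesis unfolding Diff0_def path_component_of_def by blast
qed

end

text \<open>A point \<open>q\<close> close to \<open>p\<close> is reached by a half turn about the
  midpoint of their coordinates, supported in a disc that lies in the chart and misses
  \<open>Q\<close>.\<close>

lemma local_homogeneity:
  assumes p: "p \<in> surface_interior A" "p \<notin> Q" and Q: "finite Q" "Q \<subseteq> topspace X"
  shows "\<exists>W. openin X W \<and> p \<in> W \<and> (\<forall>q\<in>W. \<exists>h\<in>Diff0 X A. h p = q \<and> (\<forall>x\<in>Q. h x = x))"
proof -
  obtain U \<phi> where c: "(U, \<phi>) \<in> A" "p \<in> U" "\<phi> p \<in> interior half_plane"
    using p(1) by (auto simp: surface_interior_def)
  have "openin (top_of_set (interior half_plane)) (interior half_plane \<inter> \<phi> ` U)"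
    using chart_image[OF c(1)] interior_subset[of half_plane]
    by (auto simp: openin_open)
  then have "open (interior half_plane \<inter> \<phi> ` U)" by (simp add: openin_open_eq)
  then have "open (interior half_plane \<inter> \<phi> ` U - \<phi> ` (Q \<inter> U))"
    by (rule open_Diff) (simp add: finite_imp_closed Q)
  moreover have "\<phi> p \<in> interior half_plane \<inter> \<phi> ` U - \<phi> ` (Q \<inter> U)"
    using c p(2) inj_on_chart[OF c(1)] by (auto dest: inj_onD)
  ultimately obtain e where e: "e > 0" "ball (\<phi> p) e \<subseteq> interior half_plane \<inter> \<phi> ` U - \<phi> ` (Q \<inter> U)"
    using openE by blast
  \<comment> \<open>In coordinates \<open>q\<close> is within e/2 of \<open>p\<close>, so the
    midpoint is within e/4, and the disc of radius e/2 about it contains \<open>p\<close> in its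
    interior and stays inside the ball of radius e.\<close>
  let ?W = "{q \<in> U. \<phi> q \<in> ball (\<phi> p) (e / 2)}"
  have "\<exists>h\<in>Diff0 X A. h p = q \<and> (\<forall>x\<in>Q. h x = x)" if q: "q \<in> ?W" for q
  proof -
    define m where "m = midpoint (\<phi> p) (\<phi> q)"
    define r where "r = dist (\<phi> p) (\<phi> q) / 2"
    have r: "r < e / 4" "norm (\<phi> p - m) = r"
      using q dist_midpoint(1)[of "\<phi> p" "\<phi> q"] by (auto simp: r_def m_def dist_norm[symmetric])
    have cb: "cball m (e / 2) \<subseteq> ball (\<phi> p) e"
    proof
      fix x assume "x \<in> cball m (e / 2)"
      then have "dist (\<phi> p) x \<le> r + e / 2"
        using dist_triangle[of "\<phi> p" x m] r(2) by (simp add: dist_norm)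
      then show "x \<in> ball (\<phi> p) e" using r e by simp
    qed
    have e2: "e / 2 > 0" using e by simp
    have cU: "cball m (e / 2) \<subseteq> \<phi> ` U" using cb e by blast
    define s where "s = pi / bump 0 ((e / 2)\<^sup>2 - (\<phi> p - m) \<bullet> (\<phi> p - m))"
    define h where "h = restrict (surface_twist U \<phi> m (e / 2) s) (topspace X)"
    have "h \<in> Diff0 X A" unfolding h_def by (rule surface_twist_Diff0[OF c(1) e2 cU])
    moreover have "h p = q"
    proof -
      have "norm (\<phi> p - m) < e / 2" using r e by simp
      from twist_half_turn[OF this] have "twist m (e / 2) s (\<phi> p) = \<phi> q"
        by (simp add: s_def m_def midpoint_def)
      then show ?thesis using c q chart_subset[OF c(1)]
        by (auto simp: h_def surface_twist_def)
    qed
    moreover have "h x = x" if "x \<in> Q" for x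
    proof -
      have "\<phi> x \<notin> cball m (e / 2)" if "x \<in> U" using cb e that \<open>x \<in> Q\<close> by blast
      then show ?thesis
        using surface_twist_outside[OF c(1) e2 cU, of x s] Q(2) that by (auto simp: h_def)
    qed
    ultimately show ?thesis by blast
  qed
  moreover have "openin X ?W" by (rule openin_chart_preimage[OF c(1)]) simp
  moreover have "p \<in> ?W" using c e by simp
  ultimately show ?thesis by blast
qed

end

section \<open>Homogeneity of the interior\<close>

context surface
begin

section \<open>The identity component as a group\<close>

lemma Diff0_eq: "Diff0 X A = path_component_of_set (diffeo_topology X (Diff X A)) \<one>\<^bsub>diffeo_group X (Diff X A)\<^esub>"
  by (simp add: Diff0_def diffeo_group_def BijGroup_def)

lemma subgroup_Diff0: "subgroup (Diff0 X A) (BijGroup (topspace X))"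
  using group.incl_subgroup[OF group_BijGroup subgroup_Diff]
    pi0_grp.subgroup_cls_one[OF pi0_grp_diffeo[OF subgroup_Diff order_refl]]
  unfolding Diff0_eq by (simp add: diffeo_group_def)

lemma Diff0_subset: "Diff0 X A \<subseteq> Diff X A"
  using subgroup.subset[OF pi0_grp.subgroup_cls_one[OF pi0_grp_diffeo[OF subgroup_Diff order_refl]]]
  unfolding Diff0_eq by (simp add: diffeo_group_def)

lemma Diff0_compose:
  assumes "f \<in> Diff0 X A" "g \<in> Diff0 X A"
  shows "compose (topspace X) f g \<in> Diff0 X A"
proof -
  have "f \<in> Bij (topspace X)" "g \<in> Bij (topspace X)" using assms Diff0_subset DiffD(1) by auto
  then show ?thesis using subgroup.m_closed[OF subgroup_Diff0 assms] by (simp add: mult_BijGroup)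
qed

lemma Diff0_inverse:
  assumes "f \<in> Diff0 X A"
  shows "\<exists>g\<in>Diff0 X A. \<forall>x\<in>topspace X. g (f x) = x"
proof -
  have f: "f \<in> Bij (topspace X)" using assms Diff0_subset DiffD(1) by auto
  then have "restrict (inv_into (topspace X) f) (topspace X) \<in> Diff0 X A"
    using subgroup.m_inv_closed[OF subgroup_Diff0 assms] by (simp add: inv_BijGroup)
  moreover have "restrict (inv_into (topspace X) f) (topspace X) (f x) = x" if "x \<in> topspace X" for x
    using f that Bij_imp_funcset[OF f] by (auto simp: Bij_def bij_betw_def)
  ultimately show ?thesis by blast
qed

lemma surface_interior_subset: "surface_interior A \<subseteq> topspace X"
  using chart_subset by (fastforce simp: surface_interior_def)

section \<open>Interior points in charts\<close>

lemma open_chart_image: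
  assumes "(U, \<phi>) \<in> A" "openin X N" "N \<subseteq> U"
  shows "open (interior half_plane \<inter> \<phi> ` N)"
proof -
  have "openin (top_of_set (interior half_plane)) (interior half_plane \<inter> \<phi> ` N)"
    using openin_chart_image[OF assms] interior_subset[of half_plane]
    by (auto simp: openin_open)
  then show ?thesis by (simp add: openin_open_eq)
qed

lemma chart_in_half_plane: "(U, \<phi>) \<in> A \<Longrightarrow> p \<in> U \<Longrightarrow> \<phi> p \<in> half_plane"
  using chart_image openin_imp_subset by blast

text \<open>Invariance of domain: an injective continuous image of an open planar set that lies in the
  half-plane lies in its interior.\<close>

lemma injective_image_interior:
  assumes f: "continuous_map X X f" "inj_on f (topspace X)"
    and p: "p \<in> surface_interior A" and V: "(V, \<psi>) \<in> A" "f p \<in> V"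
  shows "\<psi> (f p) \<in> interior half_plane"
proof -
  obtain U \<phi> where U: "(U, \<phi>) \<in> A" "p \<in> U" "\<phi> p \<in> interior half_plane"
    using p by (auto simp: surface_interior_def)
  let ?M = "{x \<in> U. f x \<in> V}"
  define N where "N = interior half_plane \<inter> \<phi> ` ?M"
  let ?g = "\<lambda>x. \<psi> (f (inv_into U \<phi> x))"
  have "open N" unfolding N_def
    by (rule open_chart_image[OF U(1) openin_chart_Collect[OF f(1) U(1) V(1)]]) auto
  moreover have "continuous_on N ?g"
  proof -
    have "N \<subseteq> \<phi> ` U" by (auto simp: N_def)
    then have "continuous_map (top_of_set N) X (\<lambda>x. f (inv_into U \<phi> x))"
      using continuous_map_compose[OF continuous_map_from_subtopology_mono[OF continuous_inv_chart[OF U(1)]] f(1)]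
      by (simp add: o_def)
    then have "continuous_map (top_of_set N) (subtopology X V) (\<lambda>x. f (inv_into U \<phi> x))"
      using U by (auto simp: continuous_map_in_subtopology N_def)
    from continuous_map_compose[OF this continuous_chart[OF V(1)]] show ?thesis by (simp add: o_def)
  qed
  moreover have "inj_on ?g N"
  proof (rule inj_onI)
    fix x y assume "x \<in> N" "y \<in> N" and eq: "?g x = ?g y"
    then obtain a b where ab: "x = \<phi> a" "y = \<phi> b" "a \<in> ?M" "b \<in> ?M" by (auto simp: N_def)
    then have "f a = f b" using eq U inj_onD[OF inj_on_chart[OF V(1)]] by auto
    then have "a = b" using ab chart_subset[OF U(1)] f(2) by (auto dest: inj_onD)
    then show "x = y" using ab by simp
  qed
  ultimately have "open (?g ` N)" by (intro invariance_of_domain)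
  moreover have "?g ` N \<subseteq> half_plane"
    using U chart_in_half_plane[OF V(1)] by (auto simp: N_def)
  ultimately have "?g ` N \<subseteq> interior half_plane" by (rule interior_maximal[rotated])
  moreover have "\<phi> p \<in> N" using U V by (auto simp: N_def)
  ultimately have "?g (\<phi> p) \<in> interior half_plane" by blast
  then show ?thesis using U by simp
qed

text \<open>\<open>surface_interior\<close> asks for one suitable chart; the preceding lemma,
  applied to the identity, shows that every chart around the point gives the same answer.\<close>

lemma chart_interior_iff:
  assumes "(V, \<psi>) \<in> A" "p \<in> V"
  shows "p \<in> surface_interior A \<longleftrightarrow> \<psi> p \<in> interior half_plane"
  using injective_image_interior[of "\<lambda>x. x" p V \<psi>] assms
  by (auto simp: surface_interior_def continuous_map_id[unfolded id_def])

lemma Diff_surface_interior: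
  assumes "f \<in> Diff X A" "p \<in> surface_interior A"
  shows "f p \<in> surface_interior A"
proof -
  have "f p \<in> topspace X"
    using assms surface_interior_subset DiffD(2) continuous_map_image_subset_topspace by blast
  then obtain V \<psi> where V: "(V, \<psi>) \<in> A" "f p \<in> V" using chart_cover by blast
  have "inj_on f (topspace X)" using DiffD(4)[OF assms(1)] by (simp add: bij_betw_def)
  from injective_image_interior[OF DiffD(2)[OF assms(1)] this assms(2) V]
  show ?thesis using chart_interior_iff[OF V] by simp
qed

lemma interior_half_plane: "interior half_plane = {x. 0 < x $ 1}"
  by (simp add: half_plane_def)

lemma convex_interior_half_plane: "convex (interior half_plane)"
  unfolding interior_half_plane by (auto simp: convex_alt intro: add_pos_nonneg) (smt (verit) mult_nonneg_nonneg mult_pos_pos)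

text \<open>The point \<open>x\<close> may lie on the boundary or in \<open>Q\<close>. A coordinate
  ball meets the open half-plane in a convex open set, which finitely many punctures cannot
  disconnect in the plane.\<close>

lemma punctured_interior_locally_connected:
  assumes x: "x \<in> topspace X" and Q: "finite Q"
  shows "\<exists>W. openin X W \<and> x \<in> W \<and> connectedin X (W \<inter> (surface_interior A - Q))"
proof -
  obtain U \<phi> where U: "(U, \<phi>) \<in> A" "x \<in> U" using chart_cover[OF x] by blast
  obtain O' where O': "open O'" "\<phi> ` U = half_plane \<inter> O'"
    using chart_image[OF U(1)] by (auto simp: openin_open)
  have "\<phi> x \<in> half_plane \<inter> O'" unfolding O'(2)[symmetric] using U(2) by (rule imageI)
  then obtain e where e: "e > 0" "ball (\<phi> x) e \<subseteq> O'" using O'(1) openE by blast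
  let ?W = "{p \<in> U. \<phi> p \<in> ball (\<phi> x) e}"
  let ?Z = "ball (\<phi> x) e \<inter> interior half_plane - \<phi> ` (Q \<inter> U)"
  have "connected ?Z"
    by (rule connected_open_delete_finite)
      (auto simp: Q intro!: convex_connected convex_Int convex_interior_half_plane)
  moreover have ZU: "?Z \<subseteq> \<phi> ` U" using e O' interior_subset[of half_plane] by auto
  ultimately have "connectedin (top_of_set (\<phi> ` U)) ?Z" by (simp add: connectedin_subtopology)
  then have "connectedin X (inv_into U \<phi> ` ?Z)"
    using connectedin_continuous_map_image[OF continuous_inv_chart[OF U(1)]] by blast
  moreover have eq: "inv_into U \<phi> ` ?Z = ?W \<inter> (surface_interior A - Q)"
  proof
    show "inv_into U \<phi> ` ?Z \<subseteq> ?W \<inter> (surface_interior A - Q)"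
    proof
      fix p assume "p \<in> inv_into U \<phi> ` ?Z"
      then obtain z where z: "z \<in> ?Z" "p = inv_into U \<phi> z" by blast
      then obtain q where q: "q \<in> U" "z = \<phi> q" using ZU by blast
      then have "p = q" using z U(1) by simp
      then show "p \<in> ?W \<inter> (surface_interior A - Q)"
        using z(1) q chart_interior_iff[OF U(1) q(1)] by auto
    qed
    show "?W \<inter> (surface_interior A - Q) \<subseteq> inv_into U \<phi> ` ?Z"
    proof
      fix p assume p: "p \<in> ?W \<inter> (surface_interior A - Q)"
      then have "\<phi> p \<in> ?Z"
        using chart_interior_iff[OF U(1)] inj_onD[OF inj_on_chart[OF U(1)]] by auto
      then have "inv_into U \<phi> (\<phi> p) \<in> inv_into U \<phi> ` ?Z" by (rule imageI)
      then show "p \<in> inv_into U \<phi> ` ?Z" using p U(1) by simp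
    qed
  qed
  moreover have "openin X ?W" by (rule openin_chart_preimage[OF U(1)]) simp
  moreover have "x \<in> ?W" using U e by simp
  ultimately have "openin X ?W \<and> x \<in> ?W \<and> connectedin X (?W \<inter> (surface_interior A - Q))"
    unfolding eq by (intro conjI)
  then show ?thesis by (rule exI)
qed

lemma punctured_interior_dense:
  assumes W: "openin X W" "x \<in> W" and Q: "finite Q"
  shows "W \<inter> (surface_interior A - Q) \<noteq> {}"
proof -
  have "x \<in> topspace X" using W openin_subset by blast
  then obtain U \<phi> where U: "(U, \<phi>) \<in> A" "x \<in> U" using chart_cover by blast
  have "openin X (W \<inter> U)" using W openin_chart[OF U(1)] by blast
  then obtain O' where O': "open O'" "\<phi> ` (W \<inter> U) = half_plane \<inter> O'"
    using openin_chart_image[OF U(1), of "W \<inter> U"] by (auto simp: openin_open)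
  have "\<phi> x \<in> half_plane \<inter> O'" unfolding O'(2)[symmetric] using U(2) W(2) by blast
  then obtain e where e: "e > 0" "ball (\<phi> x) e \<subseteq> O'" using O'(1) openE by blast
  let ?Z = "ball (\<phi> x) e \<inter> interior half_plane"
  \<comment> \<open>A shift along the first axis leads off the boundary line without leaving the
    ball, so \<open>?Z\<close> is nonempty and open, hence infinite.\<close>
  have "\<phi> x + (e / 2) *\<^sub>R axis 1 1 \<in> ?Z"
    using e(1) chart_in_half_plane[OF U] by (simp add: interior_half_plane half_plane_def dist_norm norm_axis_1)
  then have "infinite ?Z"
    using finite_imp_not_open[of ?Z] by blast
  then obtain z where z: "z \<in> ?Z" "z \<notin> \<phi> ` Q"
    using Q by (meson finite_imageI finite_subset subsetI)
  then have "z \<in> half_plane \<inter> O'" using e interior_subset[of half_plane] by auto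
  then obtain p where p: "p \<in> W" "p \<in> U" "z = \<phi> p" using O'(2) by blast
  then have "p \<in> surface_interior A - Q" using z chart_interior_iff[OF U(1) p(2)] by auto
  then show ?thesis using p by blast
qed

text \<open>The moves fixing \<open>Q\<close> form a group, so their orbits partition the punctured
  interior. Each orbit is open by \<open>local_homogeneity\<close>, and a second orbit would
  disconnect the surface.\<close>

lemma homogeneity:
  assumes conn: "connected_space X"
    and Q: "finite Q" "Q \<subseteq> topspace X"
    and s: "s \<in> surface_interior A - Q" and p: "p \<in> surface_interior A - Q"
  shows "\<exists>h\<in>Diff0 X A. h s = p \<and> (\<forall>x\<in>Q. h x = x)"
proof -
  let ?E = "surface_interior A - Q"
  define C where "C = {q \<in> ?E. \<exists>h\<in>Diff0 X A. h s = q \<and> (\<forall>x\<in>Q. h x = x)}"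
  \<comment> \<open>\<open>O1\<close> and \<open>O2\<close> are the largest open sets of the surface
    whose traces on \<open>?E\<close> lie in \<open>C\<close> and avoid \<open>C\<close>; unlike
    \<open>C\<close> itself, they can be tested against connectedness of \<open>X\<close>.\<close>
  define O1 where "O1 = \<Union>{W. openin X W \<and> W \<inter> ?E \<subseteq> C}"
  define O2 where "O2 = \<Union>{W. openin X W \<and> W \<inter> ?E \<inter> C = {}}"
  have sX: "s \<in> topspace X" using s surface_interior_subset by blast
  have op: "openin X O1" "openin X O2" unfolding O1_def O2_def by blast+
  have dec: "q \<in> C \<longrightarrow> q \<in> O1" "q \<notin> C \<longrightarrow> q \<in> O2" if q: "q \<in> ?E" for q
  proof -
    obtain W where W: "openin X W" "q \<in> W"
      and hW: "\<And>r. r \<in> W \<Longrightarrow> \<exists>h\<in>Diff0 X A. h q = r \<and> (\<forall>x\<in>Q. h x = x)"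
      using local_homogeneity[of q Q] q Q by blast
    have qX: "q \<in> topspace X" using W openin_subset by blast
    show "q \<in> C \<longrightarrow> q \<in> O1"
    proof
      assume "q \<in> C"
      then obtain k where k: "k \<in> Diff0 X A" "k s = q" "\<forall>x\<in>Q. k x = x" by (auto simp: C_def)
      have "r \<in> C" if r: "r \<in> W" "r \<in> ?E" for r
      proof -
        obtain h where h: "h \<in> Diff0 X A" "h q = r" "\<forall>x\<in>Q. h x = x" using hW[OF r(1)] by blast
        have "compose (topspace X) h k s = r" "\<forall>x\<in>Q. compose (topspace X) h k x = x"
          using h k sX Q(2) by (auto simp: compose_def)
        then show ?thesis using Diff0_compose[OF h(1) k(1)] r(2) unfolding C_def by blast
      qed
      then show "q \<in> O1" using W unfolding O1_def by blast
    qed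
    show "q \<notin> C \<longrightarrow> q \<in> O2"
    proof
      assume qC: "q \<notin> C"
      have "r \<notin> C" if r: "r \<in> W" "r \<in> ?E" for r
      proof
        assume "r \<in> C"
        then obtain k where k: "k \<in> Diff0 X A" "k s = r" "\<forall>x\<in>Q. k x = x" by (auto simp: C_def)
        obtain h where h: "h \<in> Diff0 X A" "h q = r" "\<forall>x\<in>Q. h x = x" using hW[OF r(1)] by blast
        obtain g where g: "g \<in> Diff0 X A" "\<forall>x\<in>topspace X. g (h x) = x" using Diff0_inverse[OF h(1)] by blast
        \<comment> \<open>If a neighbour \<open>r\<close> of \<open>q\<close> is reached from
          \<open>s\<close>, undoing the move from \<open>q\<close> to \<open>r\<close> reaches
          \<open>q\<close>.\<close>
        have "compose (topspace X) g k s = q" using g h k sX qX by (auto simp: compose_def)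
        moreover have "compose (topspace X) g k x = x" if x: "x \<in> Q" for x
        proof -
          have "x \<in> topspace X" using x Q(2) by blast
          then show ?thesis using g(2) h(3) k(3) x by (metis compose_eq)
        qed
        ultimately have "q \<in> C" using Diff0_compose[OF g(1) k(1)] q unfolding C_def by blast
        then show False using qC by simp
      qed
      then show "q \<in> O2" using W unfolding O2_def by blast
    qed
  qed
  have disjE: "O1 \<inter> O2 \<inter> ?E = {}" unfolding O1_def O2_def by blast
  \<comment> \<open>An overlap would be open and so contain a point of the dense set
    \<open>?E\<close>, which would lie both in \<open>C\<close> and outside it.\<close>
  have "O1 \<inter> O2 = {}"
  proof (rule ccontr)
    assume "O1 \<inter> O2 \<noteq> {}"
    then obtain x where "x \<in> O1 \<inter> O2" by blast
    then show False using punctured_interior_dense[of "O1 \<inter> O2" x Q] op Q(1) disjE by auto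
  qed
  moreover have "topspace X \<subseteq> O1 \<union> O2"
  proof
    fix x assume "x \<in> topspace X"
    then obtain W where W: "openin X W" "x \<in> W" "connectedin X (W \<inter> ?E)"
      using punctured_interior_locally_connected Q(1) by blast
    \<comment> \<open>By connectedness the trace of \<open>W\<close> lies wholly in the orbit or
      wholly outside it, so \<open>W\<close> is one of the sets joined in \<open>O1\<close> or
      \<open>O2\<close>.\<close>
    have "W \<inter> ?E \<subseteq> O1 \<union> O2" using dec by blast
    moreover have "O1 \<inter> O2 \<inter> (W \<inter> ?E) = {}" using disjE by blast
    ultimately have "O1 \<inter> (W \<inter> ?E) = {} \<or> O2 \<inter> (W \<inter> ?E) = {}"
      using W(3) op unfolding connectedin by blast
    then have "W \<inter> ?E \<inter> C = {} \<or> W \<inter> ?E \<subseteq> C" using dec by blast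
    then show "x \<in> O1 \<union> O2" using W(1,2) unfolding O1_def O2_def by blast
  qed
  ultimately have "O1 = {} \<or> O2 = {}"
    using conn op unfolding connected_space_def by blast
  moreover have "s \<in> O1"
  proof -
    have "restrict (\<lambda>x. x) (topspace X) \<in> Diff0 X A"
      using subgroup.one_closed[OF subgroup_Diff0] by (simp add: BijGroup_def)
    moreover have "restrict (\<lambda>x. x) (topspace X) s = s" "\<forall>x\<in>Q. restrict (\<lambda>x. x) (topspace X) x = x"
      using sX Q(2) by auto
    ultimately have "s \<in> C" using s unfolding C_def by blast
    then show ?thesis using dec s by blast
  qed
  ultimately have "p \<in> C" using dec p by blast
  then show ?thesis unfolding C_def by blast
qed

text \<open>Exchange argument: equal cardinality yields a point \<open>s\<close> of \<open>S\<close>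
  outside \<open>P\<close> and a point \<open>p\<close> of \<open>P\<close> outside
  \<open>S\<close>. Moving \<open>s\<close> to \<open>p\<close> while fixing the rest of
  \<open>S\<close> leaves fewer points outside \<open>P\<close>.\<close>

lemma move_finite_set:
  assumes conn: "connected_space X" and P: "finite P" "P \<subseteq> surface_interior A"
    and "finite S" "S \<subseteq> surface_interior A" "card S = card P"
  shows "\<exists>h\<in>Diff0 X A. h ` S = P"
  using assms(4-)
proof (induction "card (S - P)" arbitrary: S rule: less_induct)
  case less
  have SX: "S \<subseteq> topspace X" using less.prems surface_interior_subset by blast
  show ?case
  proof (cases "S = P")
    case True
    have "restrict (\<lambda>x. x) (topspace X) \<in> Diff0 X A"
      using subgroup.one_closed[OF subgroup_Diff0] by (simp add: BijGroup_def)
    moreover have "restrict (\<lambda>x. x) (topspace X) ` S = P" using True SX by (force simp: image_iff)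
    ultimately show ?thesis by blast
  next
    case False
    then obtain s where s: "s \<in> S" "s \<notin> P"
      using card_subset_eq[of P S] card_subset_eq[of S P] P(1) less.prems by auto
    obtain p where p: "p \<in> P" "p \<notin> S"
      using False card_subset_eq[of P S] card_subset_eq[of S P] P(1) less.prems by auto
    obtain h where h: "h \<in> Diff0 X A" "h s = p" "\<forall>x\<in>S - {s}. h x = x"
    proof -
      have "finite (S - {s})" "S - {s} \<subseteq> topspace X" "s \<in> surface_interior A - (S - {s})"
        "p \<in> surface_interior A - (S - {s})"
        using less.prems s p P SX by auto
      from homogeneity[OF conn this] show ?thesis using that by blast
    qed
    have "h ` S = insert (h s) (h ` (S - {s}))" using s by blast
    moreover have "h ` (S - {s}) = S - {s}" using h(3) by simp
    ultimately have hS: "h ` S = insert p (S - {s})" using h(2) by simp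
    have "insert p (S - {s}) - P = (S - P) - {s}" using p s by blast
    moreover have "card ((S - P) - {s}) < card (S - P)"
      using s less.prems(1) by (intro card_Diff1_less) auto
    moreover have "card (insert p (S - {s})) = card P"
      using p card_insert_disjoint[of "S - {s}" p] card_Suc_Diff1[OF less.prems(1) s(1)] less.prems
      by simp
    moreover have "finite (insert p (S - {s}))" "insert p (S - {s}) \<subseteq> surface_interior A"
      using less.prems p P by auto
    ultimately obtain k where k: "k \<in> Diff0 X A" "k ` insert p (S - {s}) = P"
      using less.hyps[of "insert p (S - {s})"] by metis
    have "compose (topspace X) k h ` S = (\<lambda>x. k (h x)) ` S"
      using SX by (intro image_cong) (auto simp: compose_def)
    then have "compose (topspace X) k h ` S = k ` h ` S" by (simp add: image_image)
    then show ?thesis using Diff0_compose[OF k(1) h(1)] k hS by metis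
  qed
qed

section \<open>Paths of diffeomorphisms\<close>

lemma diffeo_inclusion:
  assumes "D \<subseteq> E" "E \<subseteq> Diff X A"
  shows diffeo_inclusion_hom: "(\<lambda>f. f) \<in> hom (diffeo_group X D) (diffeo_group X E)"
    and diffeo_inclusion_continuous: "continuous_map (diffeo_topology X D) (diffeo_topology X E) (\<lambda>f. f)"
  using assms by (auto simp: hom_def diffeo_group_def diffeo_topology_def continuous_map_in_subtopology
      continuous_map_from_subtopology[OF continuous_map_id[unfolded id_def]])

text \<open>The path is kept and only its target shrinks. With \<open>D\<close> the marked
  diffeomorphisms this is injectivity on path components.\<close>

lemma path_component_of_Diff0_Int:
  assumes "D \<subseteq> Diff X A" "f \<in> Diff0 X A" "path_component_of (diffeo_topology X D) f g"
  shows "path_component_of (diffeo_topology X (Diff0 X A \<inter> D)) f g"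
proof -
  let ?T = "diffeo_topology X D"
  obtain \<gamma> where \<gamma>: "pathin ?T \<gamma>" "\<gamma> 0 = f" "\<gamma> 1 = g"
    using assms(3) by (auto simp: path_component_of_def)
  have "\<gamma> t \<in> Diff0 X A" if t: "t \<in> {0..1}" for t
  proof -
    have "path_connectedin ?T (\<gamma> ` {0..1})" using \<gamma>(1) by (rule path_connectedin_path_image)
    then have "path_component_of ?T f (\<gamma> t)"
      using t \<gamma>(2) unfolding path_component_of by (intro exI[of _ "\<gamma> ` {0..1}"]) force
    then have "path_component_of (diffeo_topology X (Diff X A)) f (\<gamma> t)"
      by (rule path_component_of_continuous_image[OF diffeo_inclusion_continuous[OF assms(1) order_refl]])
    with assms(2) show ?thesis unfolding Diff0_def by (blast intro: path_component_of_trans)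
  qed
  moreover have "\<gamma> t \<in> D" if "t \<in> {0..1}" for t
    using \<gamma>(1) that by (auto simp: pathin_def diffeo_topology_def continuous_map_in_subtopology)
  ultimately have "pathin (diffeo_topology X (Diff0 X A \<inter> D)) \<gamma>"
    using \<gamma>(1) by (auto simp: pathin_def diffeo_topology_def continuous_map_in_subtopology)
  then show ?thesis using \<gamma>(2,3) unfolding path_component_of_def by blast
qed

end

section \<open>The exact sequence of mapping class groups\<close>

theorem theorem3p2:
  fixes X :: "'a topology" and A :: "'a chart set" and P :: "'a set" and k :: nat
  assumes "smooth_surface X A"
    and "compact_space X"
    and "connected_space X"
    and "\<not> orientable X A"
    and "k \<ge> 1"
    and "P \<subseteq> surface_interior A"
    and "finite P"
    and "card P = k"
  shows "group (reduced_MCG X A P) \<and> group (MCG_marked X A P) \<and> group (MCG X A)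
    \<and> reduced_to_marked X A P \<in> hom (reduced_MCG X A P) (MCG_marked X A P)
    \<and> inj_on (reduced_to_marked X A P) (carrier (reduced_MCG X A P))
    \<and> subgroup (reduced_to_marked X A P ` carrier (reduced_MCG X A P)) (MCG_marked X A P)
    \<and> reduced_to_marked X A P \<in> iso (reduced_MCG X A P)
        ((MCG_marked X A P)\<lparr>carrier := reduced_to_marked X A P ` carrier (reduced_MCG X A P)\<rparr>)
    \<and> exact_seq
        ([singleton_group \<one>\<^bsub>MCG X A\<^esub>, MCG X A, MCG_marked X A P, reduced_MCG X A P,
          singleton_group \<one>\<^bsub>reduced_MCG X A P\<^esub>],
         [\<lambda>_. \<one>\<^bsub>MCG X A\<^esub>, forget_marked X A, reduced_to_marked X A P,
          \<lambda>_. \<one>\<^bsub>reduced_MCG X A P\<^esub>])"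
proof -
  interpret surface X A by (rule surface.intro) fact
  define D where "D = Diff X A"
  define M where "M = Diff_marked X A P"
  define R where "R = Diff0 X A \<inter> M"
  have PX: "P \<subseteq> topspace X" using assms(6) surface_interior_subset by blast
  have sub: "R \<subseteq> M" "M \<subseteq> D" "R \<subseteq> D" by (auto simp: R_def M_def D_def Diff_marked_def)
  have M: "subgroup M (BijGroup (topspace X))" unfolding M_def by (rule subgroup_Diff_marked[OF PX])
  have R: "subgroup R (BijGroup (topspace X))" unfolding R_def
    by (rule group.subgroups_Inter_pair[OF group_BijGroup subgroup_Diff0 M])
  interpret D: pi0_grp "diffeo_group X D" "diffeo_topology X D"
    using pi0_grp_diffeo[OF subgroup_Diff] by (simp add: D_def)
  interpret M: pi0_grp "diffeo_group X M" "diffeo_topology X M"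
    using pi0_grp_diffeo[OF M] sub by (simp add: D_def)
  interpret R: pi0_grp "diffeo_group X R" "diffeo_topology X R"
    using pi0_grp_diffeo[OF R] sub by (simp add: D_def)
  have carrier: "carrier (diffeo_group X E) = E" for E :: "('a \<Rightarrow> 'a) set"
    by (simp add: diffeo_group_def)
  have one: "\<one>\<^bsub>diffeo_group X E\<^esub> = (\<lambda>x\<in>topspace X. x)" for E :: "('a \<Rightarrow> 'a) set"
    by (simp add: diffeo_group_def BijGroup_def)
  let ?GR = "reduced_MCG X A P" and ?GM = "MCG_marked X A P" and ?GD = "MCG X A"
  let ?i = "reduced_to_marked X A P" and ?j = "forget_marked X A"
  have GR: "?GR = pi0_group (diffeo_group X R) (diffeo_topology X R)"
    by (simp add: reduced_MCG_def pi0_diffeo_def R_def M_def)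
  have GM: "?GM = pi0_group (diffeo_group X M) (diffeo_topology X M)"
    by (simp add: MCG_marked_def pi0_diffeo_def M_def)
  have GD: "?GD = pi0_group (diffeo_group X D) (diffeo_topology X D)"
    by (simp add: MCG_def pi0_diffeo_def D_def)
  have cR: "carrier ?GR = R.cls ` R" and cM: "carrier ?GM = M.cls ` M" and cD: "carrier ?GD = D.cls ` D"
    by (simp_all add: GR GM GD R.carrier_pi0_group M.carrier_pi0_group D.carrier_pi0_group carrier)
  have oD: "\<one>\<^bsub>?GD\<^esub> = D.cls (\<lambda>x\<in>topspace X. x)"
    by (simp add: GD D.one_pi0_group one)
  have gR: "group ?GR" and gM: "group ?GM" and gD: "group ?GD"
    by (simp_all add: GR GM GD R.group_pi0_group M.group_pi0_group D.group_pi0_group)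

  have "M \<subseteq> Diff X A" "D \<subseteq> Diff X A" using sub by (auto simp: D_def)
  note incRM = diffeo_inclusion[OF sub(1) this(1)] and incMD = diffeo_inclusion[OF sub(2) this(2)]
  have i: "?i \<in> hom ?GR ?GM" and i_cls: "\<And>f. f \<in> R \<Longrightarrow> ?i (R.cls f) = M.cls f"
    using pi0_map_in_hom[OF R.pi0_grp_axioms M.pi0_grp_axioms incRM]
      pi0_map_cls[OF R.pi0_grp_axioms M.pi0_grp_axioms incRM]
    by (simp_all add: GR GM reduced_to_marked_def M_def carrier)
  have j: "?j \<in> hom ?GM ?GD" and j_cls: "\<And>f. f \<in> M \<Longrightarrow> ?j (M.cls f) = D.cls f"
    using pi0_map_in_hom[OF M.pi0_grp_axioms D.pi0_grp_axioms incMD]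
      pi0_map_cls[OF M.pi0_grp_axioms D.pi0_grp_axioms incMD]
    by (simp_all add: GM GD forget_marked_def D_def carrier)

  have inj: "inj_on ?i (carrier ?GR)"
  proof (rule inj_onI)
    fix C C' assume "C \<in> carrier ?GR" "C' \<in> carrier ?GR" and eq: "?i C = ?i C'"
    then obtain f g where fg: "f \<in> R" "g \<in> R" "C = R.cls f" "C' = R.cls g" by (auto simp: cR)
    have "path_component_of (diffeo_topology X M) f g"
      using eq fg i_cls M.cls_eq_iff[of f g] sub by (auto simp: carrier)
    then have "path_component_of (diffeo_topology X R) f g"
      unfolding R_def using path_component_of_Diff0_Int[of M f g] fg sub by (auto simp: R_def D_def)
    then show "C = C'" using fg R.cls_eq_iff[of f g] by (simp add: carrier)
  qed

  interpret i: group_hom ?GR ?GM ?i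
    using gR gM i by (simp add: group_hom_def group_hom_axioms_def)
  have iso: "?i \<in> iso ?GR (?GM\<lparr>carrier := ?i ` carrier ?GR\<rparr>)"
    using inj i by (auto simp: iso_def hom_def bij_betw_def)

  have ker_i: "kernel ?GR ?GM ?i = {\<one>\<^bsub>?GR\<^esub>}"
    using i.inj_iff_trivial_ker inj by blast

  have ker_j: "kernel ?GM ?GD ?j = ?i ` carrier ?GR"
  proof -
    \<comment> \<open>Trivial class in the mapping class group means membership in the identity
      component, so the kernel consists of the classes of elements of \<open>R\<close>.\<close>
    have "D.cls f = \<one>\<^bsub>?GD\<^esub> \<longleftrightarrow> f \<in> Diff0 X A" if "f \<in> M" for f
      using that sub D.cls_eq_iff[of f "\<lambda>x\<in>topspace X. x"]
      by (auto simp: oD carrier Diff0_def D_def intro: path_component_of_sym)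
    then have "kernel ?GM ?GD ?j = M.cls ` R"
      using j_cls by (auto simp: kernel_def cM R_def)
    also have "\<dots> = ?i ` carrier ?GR"
      unfolding cR image_image using i_cls by (intro image_cong) auto
    finally show ?thesis .
  qed

  have surj: "?j ` carrier ?GM = carrier ?GD"
  proof -
    have "D.cls f \<in> D.cls ` M" if f: "f \<in> D" for f
    proof -
      have "f ` P \<subseteq> surface_interior A"
        using f assms(6) Diff_surface_interior by (auto simp: D_def)
      moreover have "card (f ` P) = card P"
        using f DiffD(4)[of f] PX by (auto simp: D_def bij_betw_def intro: card_image inj_on_subset)
      \<comment> \<open>The displaced marked set is brought back to \<open>P\<close> by some
        \<open>h\<close> in the identity component; the composite of \<open>h\<close> after
        \<open>f\<close> is then a marked representative of the class of \<open>f\<close>.\<close>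
      ultimately obtain h where h: "h \<in> Diff0 X A" "h ` f ` P = P"
        using move_finite_set[OF assms(3,7,6), of "f ` P"] assms(7) by auto
      define g where "g = compose (topspace X) h f"
      have hD: "h \<in> D" using h Diff0_subset by (auto simp: D_def)
      have g: "g = h \<otimes>\<^bsub>diffeo_group X D\<^esub> f"
        using hD f DiffD(1) by (simp add: g_def diffeo_group_def mult_BijGroup D_def)
      have "g \<in> D" using D.m_closed[of h f] hD f g by (simp add: carrier)
      moreover have "g ` P = P"
      proof -
        have "g ` P = h ` f ` P" using PX by (force simp: g_def compose_def image_iff)
        then show ?thesis using h by simp
      qed
      ultimately have gM: "g \<in> M" by (simp add: M_def Diff_marked_def D_def)
      \<comment> \<open>A path from the identity to \<open>h\<close>, multiplied by \<open>f\<close>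
        on the right, joins \<open>f\<close> to \<open>g\<close>.\<close>
      have "path_component_of (diffeo_topology X D) (\<one>\<^bsub>diffeo_group X D\<^esub> \<otimes>\<^bsub>diffeo_group X D\<^esub> f) g"
        unfolding g
        by (rule D.path_component_of_mult)
          (use h f in \<open>auto simp: Diff0_def one D_def[symmetric] path_component_of_refl D.topspace_eq carrier\<close>)
      then have "path_component_of (diffeo_topology X D) f g" using f by (simp add: carrier)
      then have "D.cls f = D.cls g" using D.cls_eq_iff[of f g] f by (simp add: carrier)
      then show ?thesis using gM by blast
    qed
    then have "D.cls ` M = D.cls ` D" using sub by blast
    moreover have "?j ` carrier ?GM = D.cls ` M"
      unfolding cM image_image using j_cls by (intro image_cong) auto
    ultimately show ?thesis by (simp add: cD)
  qed

  have "(\<lambda>_. \<one>\<^bsub>?GR\<^esub>) \<in> hom (singleton_group \<one>\<^bsub>?GR\<^esub>) ?GR"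
    by (auto simp: hom_def singleton_group_def)
  then have "group_hom (singleton_group \<one>\<^bsub>?GR\<^esub>) ?GR (\<lambda>_. \<one>\<^bsub>?GR\<^esub>)"
    using gR by (simp add: group_hom_def group_hom_axioms_def)
  moreover have "kernel ?GD (singleton_group \<one>\<^bsub>?GD\<^esub>) (\<lambda>_. \<one>\<^bsub>?GD\<^esub>) = carrier ?GD"
    by (auto simp: kernel_def singleton_group_def)
  \<comment> \<open>The lists of \<open>exact_seq\<close> run against the arrows. The trivial kernel
    of \<open>?i\<close> matches the image of the singleton group, and surjectivity of
    \<open>?j\<close> matches the kernel of the constant map.\<close>
  ultimately have "exact_seq
        ([singleton_group \<one>\<^bsub>?GD\<^esub>, ?GD, ?GM, ?GR, singleton_group \<one>\<^bsub>?GR\<^esub>],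
         [\<lambda>_. \<one>\<^bsub>?GD\<^esub>, ?j, ?i, \<lambda>_. \<one>\<^bsub>?GR\<^esub>])"
    using gD gM i j ker_i ker_j surj by simp
  then show ?thesis
    using gR gM gD i inj iso i.img_is_subgroup by blast
qed

end
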